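(* Let $h:\mathbb{R}^n\to(-\infty,\infty]$ be a proper, lower semicontinuous, $\varrho$-weakly convex function ($\varrho\ge0$) bounded from below. Let $\{x^k\}$ be generated by the inexact proximal point method with momentum (IPPm, see context) on $X=\mathbb{R}^n$ with parameters $\nu\in(0,1)$, $\tau>0$, $\{\beta_k\},\{\gamma_k\}\subset[0,\infty)$, $\bar\beta=\sup_k\beta_k<1$, $\bar\delta=\sup_k|\beta_k-\gamma_k|<\infty$ and $\lambda>0$ satisfying $$\lambda\in(0,\varrho^{-1}),\qquad \max\{L\tau,\ 2L\tau\bar\delta+(L\tau+1)\bar\beta^2\}<1-\nu,\qquad\text{where } L=\max\Big\{\lambda^{-1},\frac{\varrho}{1-\lambda\varrho}\Big\},$$ and suppose that $0\notin\partial h(x^k_{\rm ex})$ for all $k\in\mathbb{N}$. Then the following hold. (i) Every accumulation point $\bar x$ of $\{x^k\}$ is a stationary point of $h$, i.e. $0\in\partial h(\bar x)$. (ii) If the Moreau envelope $e_\lambda h$ satisfies the basic PLK condition at an accumulation point $\bar x$ of $\{x^k\}$, then $x^k\to\bar x$ as $k\to\infty$. (iii) If $e_\lambda h$ satisfies the PLK condition at an accumulation point $\bar x$ of $\{x^k\}$ with desingularizing function $\psi(t)=Mt^{1-q}$ for some $M>0$ and $q\in[0,1)$, then: - for $q\in[0,1/2]$, the sequences $\{x^k\}$ and $\{x^k-\mathrm{Prox}_{\lambda h}(x^k)\}$ converge linearly to $\bar x$ and $0$, respectively; - for $q\in(1/2,1)$, $\|x^k-\bar x\|=\mathcal{O}\big(k^{-\frac{1-q}{2q-1}}\big)$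 and $\|x^k-\mathrm{Prox}_{\lambda h}(x^k)\|=\mathcal{O}\big(k^{-\frac{1-q}{2q-1}}\big)$ as $k\to\infty$.
   Context: $\|\cdot\|$ is the Euclidean norm, $\mathbb{N}=\{1,2,\dots\}$; $\varrho^{-1}=\infty$ if $\varrho=0$. $h$ is $\varrho$-weakly convex if $h+\frac{\varrho}{2}\|\cdot\|^2$ is convex on $\mathbb{R}^n$. Regular subdifferential at $\bar x\in\mathrm{dom}\,h$: $\widehat\partial h(\bar x)=\{v:\liminf_{x\to\bar x}\frac{h(x)-h(\bar x)-\langle v,x-\bar x\rangle}{\|x-\bar x\|}\ge0\}$. Limiting subdifferential: $\partial h(\bar x)=\{v:\exists\,x^k\to\bar x,\ h(x^k)\to h(\bar x),\ v^k\in\widehat\partial h(x^k),\ v^k\to v\}$ (empty if $\bar x\notin\mathrm{dom}\,h$). Moreau envelope and proximal mapping: $e_\lambda h(x)=\inf_y\{h(y)+\frac1{2\lambda}\|y-x\|^2\}$, $\mathrm{Prox}_{\lambda h}(x)=\mathrm{argmin}_y\{h(y)+\frac1{2\lambda}\|y-x\|^2\}$. For $h$ proper, l.s.c., $\varrho$-weakly convex and $\lambda\in(0,\varrho^{-1})$, $\mathrm{Prox}_{\lambda h}$ is single-valued on $\mathbb{R}^n$ and $e_\lambda h$ is $C^1$ with $\nabla e_\lambda h(x)=\lambda^{-1}(x-\mathrm{Prox}_{\lambda h}(x))$. IPPm: choose $x^0=x^1\in X$, $\nu\in(0,1)$, $\{\beta_k\},\{\gamma_k\}\subset[0,\infty)$,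 $\lambda>0$, $\tau>0$ with $\bar\beta:=\sup_k\beta_k<1$, $\bar\delta:=\sup_k|\beta_k-\gamma_k|<\infty$. For each $k\ge1$ put $x^k_{\rm in}:=x^k+\beta_k(x^k-x^{k-1})$, $x^k_{\rm ex}:=x^k+\gamma_k(x^k-x^{k-1})$, $g^k:=\lambda^{-1}(x^k_{\rm ex}-p^k)$, where $p^k$ is any point with $\|p^k-\mathrm{Prox}_{\lambda h}(x^k_{\rm ex})\|\le\nu\|p^k-x^k_{\rm ex}\|$, and $x^{k+1}:=x^k_{\rm in}-\tau g^k$. PLK (Polyak-Łojasiewicz-Kurdyka) condition for a $C^1$ function $f$ at $\bar x$ with desingularizing function $\varphi$: there are $\eta\in(0,\infty]$, a neighborhood $U$ of $\bar x$ and a concave function $\varphi:[0,\eta)\to[0,\infty)$ such that $\varphi(0)=0$, $\varphi$ is $C^1$ on $(0,\eta)$, $\varphi'>0$ on $(0,\eta)$, and $\varphi'(f(x)-f(\bar x))\|\nabla f(x)\|\ge1$ for all $x\in U$ with $f(\bar x)<f(x)<f(\bar x)+\eta$. The basic PLK condition means that this holds with some such $\varphi$. A sequence $\{u^k\}$ converges linearly to $u$ if $\|u^k-u\|=\mathcal{O}(\mu^k)$ for some $\mu\in(0,1)$ (R-linear convergence). *)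

theory Defs
  imports "HOL-Analysis.Analysis" "HOL-Library.Landau_Symbols"
begin

definition ereal_dom :: "('a \<Rightarrow> ereal) \<Rightarrow> 'a set" where
  "ereal_dom h = {x. h x < \<infinity>}"

definition proper_fun :: "('a \<Rightarrow> ereal) \<Rightarrow> bool" where
  "proper_fun h \<longleftrightarrow> (\<forall>x. h x \<noteq> -\<infinity>) \<and> ereal_dom h \<noteq> {}"

definition lsc_fun :: "('a::topological_space \<Rightarrow> ereal) \<Rightarrow> bool" where
  "lsc_fun h \<longleftrightarrow> (\<forall>x. h x \<le> Liminf (at x) h)"

text \<open>The library's \<open>convex_on\<close> is for real-valued functions only. The inequality below
  is the usual notion for functions that do not take the value \<open>-\<infinity>\<close>, with \<open>0 * \<infinity> = 0\<close>.\<close>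

definition ereal_convex :: "('a::real_vector \<Rightarrow> ereal) \<Rightarrow> bool" where
  "ereal_convex f \<longleftrightarrow> (\<forall>x y. \<forall>t\<in>{0..1}.
     f ((1 - t) *\<^sub>R x + t *\<^sub>R y) \<le> ereal (1 - t) * f x + ereal t * f y)"

definition weakly_convex :: "real \<Rightarrow> ('a::real_normed_vector \<Rightarrow> ereal) \<Rightarrow> bool" where
  "weakly_convex \<rho> h \<longleftrightarrow> ereal_convex (\<lambda>x. h x + ereal (\<rho> / 2 * (norm x)\<^sup>2))"

definition regular_subdiff :: "('a::real_inner \<Rightarrow> ereal) \<Rightarrow> 'a \<Rightarrow> 'a set" where
  "regular_subdiff h xb = {v. xb \<in> ereal_dom h \<and>
     0 \<le> Liminf (at xb) (\<lambda>x. (h x - h xb - ereal (v \<bullet> (x - xb))) / ereal (norm (x - xb)))}"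

definition limiting_subdiff :: "('a::real_inner \<Rightarrow> ereal) \<Rightarrow> 'a \<Rightarrow> 'a set" where
  "limiting_subdiff h xb = {v. xb \<in> ereal_dom h \<and>
     (\<exists>y w. y \<longlonglongrightarrow> xb \<and> (\<lambda>k. h (y k)) \<longlonglongrightarrow> h xb \<and>
            (\<forall>k. w k \<in> regular_subdiff h (y k)) \<and> w \<longlonglongrightarrow> v)}"

definition prox_objective ::
  "real \<Rightarrow> ('a::real_normed_vector \<Rightarrow> ereal) \<Rightarrow> 'a \<Rightarrow> 'a \<Rightarrow> ereal" where
  "prox_objective lam h x y = h y + ereal (1 / (2 * lam) * (norm (y - x))\<^sup>2)"

definition moreau_envelope ::
  "real \<Rightarrow> ('a::real_normed_vector \<Rightarrow> ereal) \<Rightarrow> 'a \<Rightarrow> ereal" where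
  "moreau_envelope lam h x = (INF y. prox_objective lam h x y)"

definition Prox_set ::
  "real \<Rightarrow> ('a::real_normed_vector \<Rightarrow> ereal) \<Rightarrow> 'a \<Rightarrow> 'a set" where
  "Prox_set lam h x = {y. is_arg_min (prox_objective lam h x) (\<lambda>_. True) y}"

text \<open>\<open>Prox\<close> is meaningful where \<open>Prox_set\<close> is a singleton, which is the case for
  proper, l.s.c., \<open>\<rho>\<close>-weakly convex \<open>h\<close> and \<open>0 < lam < 1 / \<rho>\<close>.\<close>

definition Prox :: "real \<Rightarrow> ('a::real_normed_vector \<Rightarrow> ereal) \<Rightarrow> 'a \<Rightarrow> 'a" where
  "Prox lam h x = the_elem (Prox_set lam h x)"

definition extrapolation ::
  "(nat \<Rightarrow> real) \<Rightarrow> (nat \<Rightarrow> 'a::real_vector) \<Rightarrow> nat \<Rightarrow> 'a" where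
  "extrapolation c x k = x k + c k *\<^sub>R (x k - x (k - 1))"

text \<open>The iteration is indexed by \<open>k \<ge> 1\<close>; the values of \<open>\<beta>\<close>, \<open>\<gamma>\<close> and \<open>p\<close> at \<open>0\<close> are
  irrelevant.\<close>

definition IPPm ::
  "('a::real_normed_vector \<Rightarrow> ereal) \<Rightarrow> real \<Rightarrow> real \<Rightarrow> real \<Rightarrow> (nat \<Rightarrow> real) \<Rightarrow> (nat \<Rightarrow> real)
    \<Rightarrow> (nat \<Rightarrow> 'a) \<Rightarrow> (nat \<Rightarrow> 'a) \<Rightarrow> bool" where
  "IPPm h lam \<tau> \<nu> \<beta> \<gamma> p x \<longleftrightarrow> x 0 = x 1 \<and>
     (\<forall>k\<ge>1.
        let x_in = extrapolation \<beta> x k;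
            x_ex = extrapolation \<gamma> x k;
            g = (1 / lam) *\<^sub>R (x_ex - p k)
        in norm (p k - Prox lam h x_ex) \<le> \<nu> * norm (p k - x_ex) \<and>
           x (k + 1) = x_in - \<tau> *\<^sub>R g)"

definition accumulation_point :: "(nat \<Rightarrow> 'a::topological_space) \<Rightarrow> 'a \<Rightarrow> bool" where
  "accumulation_point x xb \<longleftrightarrow> (\<exists>r. strict_mono r \<and> (x \<circ> r) \<longlonglongrightarrow> xb)"

definition converges_linearly :: "(nat \<Rightarrow> 'a::real_normed_vector) \<Rightarrow> 'a \<Rightarrow> bool" where
  "converges_linearly u ub \<longleftrightarrow>
     (\<exists>\<mu>. 0 < \<mu> \<and> \<mu> < 1 \<and> (\<lambda>k. norm (u k - ub)) \<in> O(\<lambda>k. \<mu> ^ k))"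

definition grad :: "('a::real_inner \<Rightarrow> real) \<Rightarrow> 'a \<Rightarrow> 'a" where
  "grad f x = (THE g. GDERIV f x :> g)"

text \<open>The condition is intended for continuously differentiable \<open>f\<close>. Only the values of
  \<open>\<phi>\<close> on \<open>[0, \<eta>)\<close> matter.\<close>

definition PLK_with :: "('a::real_inner \<Rightarrow> real) \<Rightarrow> 'a \<Rightarrow> (real \<Rightarrow> real) \<Rightarrow> bool" where
  "PLK_with f xb \<phi> \<longleftrightarrow> (\<exists>(\<eta>::ereal) U.
     0 < \<eta> \<and> open U \<and> xb \<in> U \<and>
     concave_on {t. 0 \<le> t \<and> ereal t < \<eta>} \<phi> \<and>
     (\<forall>t. 0 \<le> t \<and> ereal t < \<eta> \<longrightarrow> 0 \<le> \<phi> t) \<and>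
     \<phi> 0 = 0 \<and>
     \<phi> C1_differentiable_on {t. 0 < t \<and> ereal t < \<eta>} \<and>
     (\<forall>t. 0 < t \<and> ereal t < \<eta> \<longrightarrow> 0 < deriv \<phi> t) \<and>
     (\<forall>x\<in>U. f xb < f x \<and> ereal (f x) < ereal (f xb) + \<eta> \<longrightarrow>
        1 \<le> deriv \<phi> (f x - f xb) * norm (grad f x)))"

definition basic_PLK :: "('a::real_inner \<Rightarrow> real) \<Rightarrow> 'a \<Rightarrow> bool" where
  "basic_PLK f xb \<longleftrightarrow> (\<exists>\<phi>. PLK_with f xb \<phi>)"

end

theory Submission
  imports Defs
begin

text \<open>The iteration is an inexact gradient method with momentum for the Moreau envelope \<open>f\<close>,
  whose gradient is \<open>G y = (y - Prox y) / lam\<close>. Comparing the two proximal subproblems gives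
  quadratic bounds on \<open>f\<close> from both sides, so \<open>f\<close> is differentiable, and \<open>G\<close> is Lipschitz
  with constant \<open>L\<close> because the subgradients of \<open>h\<close> are hypomonotone.
  The condition on the parameters makes \<open>H k = f (x (k + 1)) + A |x (k + 1) - x k|\<^sup>2\<close>
  decrease by a multiple of \<open>s k ^ 2\<close>, where \<open>s k\<close> dominates the displacement, the inexact
  gradient and \<open>|G (x (k + 1))|\<close>; hence \<open>G\<close> vanishes at accumulation points.
  A desingularizing function \<open>\<phi>\<close> of \<open>f\<close> yields one for \<open>H\<close>, namely
  \<open>\<Phi> t = 2 \<phi> (t / 2) + 2 sqrt (2 A t)\<close>, and then \<open>s k\<close> is bounded by a multiple of
  \<open>\<Phi> (t k) - \<Phi> (t (k + 1))\<close>, where \<open>t k\<close> is the gap between \<open>H k\<close> and its limit. Telescoping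
  gives convergence. For \<open>\<phi> t = M t powr (1 - q)\<close> the gap satisfies
  \<open>t (k + 1) \<le> t k - a * t k powr (2 \<theta>)\<close> with \<open>\<theta> = max q (1 / 2)\<close>, which gives the rates.\<close>

section \<open>Proximal mapping and Moreau envelope\<close>

text \<open>The convexity defect of the squared norm is exact; weak convexity of \<open>h\<close>
  may lose \<open>\<rho> / 2\<close> times it, while the proximal term gains
  \<open>1 / (2 * lam)\<close> times it.\<close>

lemma norm_convex_combination_power2:
  fixes u v :: "'a::real_inner"
  shows "(norm ((1 - t) *\<^sub>R u + t *\<^sub>R v))\<^sup>2 =
    (1 - t) * (norm u)\<^sup>2 + t * (norm v)\<^sup>2 - t * (1 - t) * (norm (u - v))\<^sup>2"
  by (simp add: power2_norm_eq_inner inner_simps inner_commute algebra_simps)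

text \<open>The upper bound on \<open>lam\<close> is kept as \<open>lam * \<rho> < 1\<close>, which
  also covers \<open>\<rho> = 0\<close>. The lower bound \<open>c\<close> is a parameter so that
  later estimates can refer to it.\<close>

locale weakly_convex_prox =
  fixes h :: "'a::euclidean_space \<Rightarrow> ereal" and \<rho> lam c :: real
  assumes proper: "proper_fun h" and lsc: "lsc_fun h"
    and rho_nonneg: "0 \<le> \<rho>" and weak_conv: "weakly_convex \<rho> h"
    and bounded_below: "\<And>y. ereal c \<le> h y"
    and lam_pos: "0 < lam" and lam_rho: "lam * \<rho> < 1"
begin

lemma h_not_minf [simp]: "h y \<noteq> -\<infinity>"
  using proper by (auto simp: proper_fun_def)

text \<open>Expanding the square at the intermediate point cancels the quadratic shift up to its
  convexity defect. Finite end values force a finite value in between, as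
  \<open>-\<infinity>\<close> is excluded.\<close>

lemma weakly_convex_real:
  assumes "h y = ereal a" "h z = ereal b" "0 \<le> t" "t \<le> 1"
  shows "h ((1 - t) *\<^sub>R y + t *\<^sub>R z) \<le>
    ereal ((1 - t) * a + t * b + \<rho> / 2 * (t * (1 - t) * (norm (y - z))\<^sup>2))"
proof -
  let ?w = "(1 - t) *\<^sub>R y + t *\<^sub>R z"
  have *: "h ?w + ereal (\<rho> / 2 * (norm ?w)\<^sup>2) \<le>
     ereal (1 - t) * (h y + ereal (\<rho> / 2 * (norm y)\<^sup>2)) +
     ereal t * (h z + ereal (\<rho> / 2 * (norm z)\<^sup>2))"
    using weak_conv assms(3,4) unfolding weakly_convex_def ereal_convex_def by auto
  then obtain r where r: "h ?w = ereal r"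
    using assms(1,2) by (cases "h ?w") auto
  show ?thesis
    using * unfolding r assms(1,2) norm_convex_combination_power2
    by (simp add: algebra_simps diff_divide_distrib)
qed

section \<open>Existence and uniqueness of proximal points\<close>

lemma sublevel_closed:
  "closed {y. prox_objective lam h x y \<le> ereal a}"
proof -
  let ?q = "\<lambda>y. 1 / (2 * lam) * (norm (y - x))\<^sup>2"
  have "open {y. prox_objective lam h x y > ereal a}"
  proof (subst open_subopen, rule ballI)
    fix z assume "z \<in> {y. prox_objective lam h x y > ereal a}"
    then have "ereal (a - ?q z) < h z"
      by (cases "h z") (auto simp: prox_objective_def algebra_simps)
    \<comment> \<open>\<open>m\<close> splits the strict inequality: near \<open>z\<close>,
      semicontinuity keeps \<open>h\<close> above \<open>m\<close> and continuity keeps the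
      quadratic above \<open>a - m\<close>.\<close>
    then obtain m where m: "ereal (a - ?q z) < ereal m" "ereal m < h z"
      using ereal_dense2 by blast
    have "h z \<le> Liminf (at z) h"
      using lsc by (simp add: lsc_fun_def)
    then have "eventually (\<lambda>y. ereal m < h y) (at z)"
      using m(2) by (auto simp: le_Liminf_iff)
    then have 1: "eventually (\<lambda>y. ereal m < h y) (nhds z)"
      using m(2) by (simp add: eventually_nhds_conv_at)
    have "(?q \<longlongrightarrow> ?q z) (nhds z)"
      by (intro tendsto_intros filterlim_ident)
    then have 2: "eventually (\<lambda>y. ?q y > a - m) (nhds z)"
      using m(1) by (auto intro: order_tendstoD)
    have "eventually (\<lambda>y. prox_objective lam h x y > ereal a) (nhds z)"
      using 1 2
    proof eventually_elim
      case (elim y)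
      then show ?case
        by (cases "h y") (auto simp: prox_objective_def)
    qed
    then show "\<exists>T. open T \<and> z \<in> T \<and> T \<subseteq> {y. prox_objective lam h x y > ereal a}"
      by (auto simp: eventually_nhds)
  qed
  then show ?thesis
    by (simp add: closed_def Compl_eq not_le)
qed

text \<open>The lower bound on \<open>h\<close> makes the proximal objective coercive, so its
  sublevel sets slightly above the infimum \<open>I\<close> are compact, nonempty and nested; a
  common point attains \<open>I\<close>.\<close>

lemma Prox_set_nonempty: "Prox_set lam h x \<noteq> {}"
proof -
  let ?Q = "prox_objective lam h x"
  obtain y0 a0 where y0: "h y0 = ereal a0"
  proof -
    obtain y0 where "h y0 < \<infinity>"
      using proper by (auto simp: proper_fun_def ereal_dom_def)
    then show ?thesis using that by (cases "h y0") auto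
  qed
  have Q_lower: "ereal (c + 1 / (2 * lam) * (norm (y - x))\<^sup>2) \<le> ?Q y" for y
    using add_right_mono[OF bounded_below[of y], of "ereal (1 / (2 * lam) * (norm (y - x))\<^sup>2)"]
    by (simp add: prox_objective_def)
  have Q_lower': "ereal c \<le> ?Q y" for y
  proof -
    have "ereal c \<le> ereal (c + 1 / (2 * lam) * (norm (y - x))\<^sup>2)"
      using lam_pos by simp
    then show ?thesis using Q_lower order_trans by blast
  qed
  have "ereal c \<le> (INF y. ?Q y)"
    by (intro INF_greatest Q_lower')
  moreover have "(INF y. ?Q y) \<le> ?Q y0"
    by (rule INF_lower) simp
  moreover have "?Q y0 < \<infinity>"
    by (simp add: prox_objective_def y0)
  ultimately obtain I where I: "(INF y. ?Q y) = ereal I"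
    by (cases "INF y. ?Q y") auto
  define F where "F n = {y. ?Q y \<le> ereal (I + 1 / real (Suc n))}" for n
  have "compact (F n)" for n
  proof -
    have "bounded (F n)"
    proof -
      have "F n \<subseteq> cball x (sqrt (2 * lam * (I + 1 / real (Suc n) - c)))"
      proof
        fix y assume "y \<in> F n"
        then have "ereal (c + 1 / (2 * lam) * (norm (y - x))\<^sup>2) \<le> ereal (I + 1 / real (Suc n))"
          using order_trans[OF Q_lower[of y], of "ereal (I + 1 / real (Suc n))"] by (auto simp: F_def)
        then have "(norm (y - x))\<^sup>2 \<le> 2 * lam * (I + 1 / real (Suc n) - c)"
          using lam_pos by (simp add: field_simps)
        then show "y \<in> cball x (sqrt (2 * lam * (I + 1 / real (Suc n) - c)))"
          by (simp add: dist_norm norm_minus_commute real_le_rsqrt)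
      qed
      then show ?thesis using bounded_cball bounded_subset by blast
    qed
    then show ?thesis
      using sublevel_closed by (auto simp: F_def compact_eq_bounded_closed)
  qed
  moreover have "F n \<noteq> {}" for n
  proof -
    have "(INF y. ?Q y) < ereal (I + 1 / real (Suc n))"
      by (simp add: I)
    then show ?thesis
      by (auto simp: INF_less_iff F_def intro: less_imp_le)
  qed
  moreover have "F n \<subseteq> F m" if "m \<le> n" for m n
  proof -
    have "1 / real (Suc n) \<le> 1 / real (Suc m)"
      using that by (simp add: field_simps)
    then have "ereal (I + 1 / real (Suc n)) \<le> ereal (I + 1 / real (Suc m))"
      by simp
    then show ?thesis
      unfolding F_def using order_trans by blast
  qed
  ultimately have "\<Inter>(range F) \<noteq> {}"
    by (rule compact_nest)
  then obtain z where z: "\<And>n. ?Q z \<le> ereal (I + 1 / real (Suc n))"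
    by (auto simp: F_def)
  have "?Q z \<le> ereal I"
  proof (rule LIMSEQ_le_const)
    show "(\<lambda>n. ereal (I + 1 / real (Suc n))) \<longlonglongrightarrow> ereal I"
      using tendsto_add[OF tendsto_const LIMSEQ_inverse_real_of_nat, of I]
      by (simp add: inverse_eq_divide)
  qed (use z in auto)
  then have "?Q z \<le> ?Q y" for y
    using I INF_lower[of y UNIV ?Q] by auto
  then show ?thesis
    unfolding Prox_set_def is_arg_min_linorder by blast
qed

lemma Prox_set_finite_value:
  assumes "p \<in> Prox_set lam h x"
  obtains a where "h p = ereal a"
proof -
  obtain y0 where "h y0 < \<infinity>"
    using proper by (auto simp: proper_fun_def ereal_dom_def)
  moreover have "prox_objective lam h x p \<le> prox_objective lam h x y0"
    using assms by (simp add: Prox_set_def is_arg_min_linorder)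
  ultimately show ?thesis
    using that by (cases "h p"; cases "h y0") (auto simp: prox_objective_def)
qed

text \<open>Minimality of \<open>p\<close> is tested on the segment towards \<open>z\<close>. After
  division by \<open>t\<close>, letting \<open>t\<close> tend to 0 gives quadratic growth whose
  modulus is the curvature of the proximal term minus that lost to weak convexity.\<close>

lemma Prox_set_strong_minimum:
  assumes p: "p \<in> Prox_set lam h x" and a: "h p = ereal a" and b: "h z = ereal b"
  shows "a + 1 / (2 * lam) * (norm (p - x))\<^sup>2 + (1 / lam - \<rho>) / 2 * (norm (z - p))\<^sup>2
    \<le> b + 1 / (2 * lam) * (norm (z - x))\<^sup>2"
proof -
  define N where "N = (norm (p - z))\<^sup>2"
  define A where "A = a + 1 / (2 * lam) * (norm (p - x))\<^sup>2"
  define B where "B = b + 1 / (2 * lam) * (norm (z - x))\<^sup>2"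
  have ineq: "A + (1 / lam - \<rho>) / 2 * ((1 - t) * N) \<le> B" if t: "0 < t" "t < 1" for t
  proof -
    let ?w = "(1 - t) *\<^sub>R p + t *\<^sub>R z"
    have "?w - x = (1 - t) *\<^sub>R (p - x) + t *\<^sub>R (z - x)"
      by (simp add: algebra_simps)
    then have w: "(norm (?w - x))\<^sup>2 =
        (1 - t) * (norm (p - x))\<^sup>2 + t * (norm (z - x))\<^sup>2 - t * (1 - t) * N"
      by (simp add: norm_convex_combination_power2 N_def)
    have "prox_objective lam h x p \<le> prox_objective lam h x ?w"
      using p by (simp add: Prox_set_def is_arg_min_linorder)
    also have "\<dots> \<le> ereal ((1 - t) * a + t * b + \<rho> / 2 * (t * (1 - t) * (norm (p - z))\<^sup>2))
        + ereal (1 / (2 * lam) * (norm (?w - x))\<^sup>2)"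
      unfolding prox_objective_def using t
      by (intro add_right_mono weakly_convex_real[OF a b]) auto
    finally have "A \<le> (1 - t) * a + t * b + \<rho> / 2 * (t * (1 - t) * N)
        + 1 / (2 * lam) * ((1 - t) * (norm (p - x))\<^sup>2 + t * (norm (z - x))\<^sup>2 - t * (1 - t) * N)"
      by (simp add: prox_objective_def a A_def N_def w)
    also have "\<dots> = (1 - t) * A + t * B - t * ((1 / lam - \<rho>) / 2 * ((1 - t) * N))"
      using lam_pos by (simp add: A_def B_def field_simps)
    finally have "t * (A + (1 / lam - \<rho>) / 2 * ((1 - t) * N)) \<le> t * B"
      by (simp add: algebra_simps)
    then show ?thesis
      using t by simp
  qed
  have "((\<lambda>t. A + (1 / lam - \<rho>) / 2 * ((1 - t) * N)) \<longlongrightarrow> A + (1 / lam - \<rho>) / 2 * ((1 - 0) * N))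
      (at_right 0)"
    by (intro tendsto_intros)
  moreover have "eventually (\<lambda>t. A + (1 / lam - \<rho>) / 2 * ((1 - t) * N) \<le> B) (at_right 0)"
    unfolding eventually_at_right_field using ineq by (intro exI[of _ 1]) auto
  ultimately have "A + (1 / lam - \<rho>) / 2 * ((1 - 0) * N) \<le> B"
    by (rule tendsto_upperbound) simp
  then show ?thesis
    by (simp add: A_def B_def N_def norm_minus_commute)
qed

lemma modulus_pos: "0 < 1 / lam - \<rho>"
  using lam_pos lam_rho by (simp add: field_simps)

text \<open>Quadratic growth at each minimizer, tested at the other one and added, bounds a positive
  multiple of their squared distance by 0.\<close>

lemma Prox_set_unique:
  assumes p: "p \<in> Prox_set lam h x" and p': "p' \<in> Prox_set lam h x"
  shows "p = p'"
proof -
  obtain a a' where a: "h p = ereal a" "h p' = ereal a'"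
    using assms Prox_set_finite_value by metis
  have "(1 / lam - \<rho>) * (norm (p - p'))\<^sup>2 \<le> 0"
    using Prox_set_strong_minimum[OF p a] Prox_set_strong_minimum[OF p' a(2,1)]
    by (simp add: norm_minus_commute field_simps)
  then show ?thesis
    using modulus_pos by (simp add: mult_le_0_iff)
qed

lemma Prox_set_eq: "Prox_set lam h x = {Prox lam h x}"
proof -
  obtain p where "p \<in> Prox_set lam h x"
    using Prox_set_nonempty by blast
  then have "Prox_set lam h x = {p}"
    using Prox_set_unique by blast
  then show ?thesis
    by (simp add: Prox_def)
qed

lemma Prox_in: "Prox lam h x \<in> Prox_set lam h x"
  by (simp add: Prox_set_eq)

section \<open>First-order estimates for the real-valued envelope\<close>

definition prox_value :: "'a \<Rightarrow> real" where
  "prox_value x = real_of_ereal (h (Prox lam h x))"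

definition envelope :: "'a \<Rightarrow> real" where
  "envelope x = real_of_ereal (moreau_envelope lam h x)"

text \<open>That this is the gradient is derived later, in \<open>grad_eq\<close>, from two-sided
  quadratic bounds.\<close>

definition envelope_grad :: "'a \<Rightarrow> 'a" where
  "envelope_grad x = (1 / lam) *\<^sub>R (x - Prox lam h x)"

lemma h_Prox: "h (Prox lam h x) = ereal (prox_value x)"
  using Prox_set_finite_value[OF Prox_in] by (metis prox_value_def real_of_ereal.simps(1))

lemma moreau_envelope_eq:
  "moreau_envelope lam h x = ereal (prox_value x + 1 / (2 * lam) * (norm (Prox lam h x - x))\<^sup>2)"
proof -
  have "prox_objective lam h x (Prox lam h x) \<le> prox_objective lam h x y" for y
    using Prox_in by (simp add: Prox_set_def is_arg_min_linorder)
  then have "moreau_envelope lam h x = prox_objective lam h x (Prox lam h x)"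
    unfolding moreau_envelope_def by (intro antisym INF_greatest INF_lower) auto
  then show ?thesis
    by (simp add: prox_objective_def h_Prox)
qed

lemma envelope_eq: "envelope x = prox_value x + 1 / (2 * lam) * (norm (Prox lam h x - x))\<^sup>2"
  by (simp add: envelope_def moreau_envelope_eq)

lemma envelope_lower: "c \<le> envelope x"
proof -
  have "c \<le> prox_value x"
    using bounded_below[of "Prox lam h x"] by (simp add: h_Prox)
  moreover have "0 \<le> 1 / (2 * lam) * (norm (Prox lam h x - x))\<^sup>2"
    using lam_pos by simp
  ultimately show ?thesis
    by (simp add: envelope_eq)
qed

lemma Prox_eq: "Prox lam h x = x - lam *\<^sub>R envelope_grad x"
  using lam_pos by (simp add: envelope_grad_def)

text \<open>Quadratic growth with the square re-expanded around the proximal point: the curvature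
  \<open>1 / lam\<close> cancels and only the weak convexity term survives. Thus
  \<open>envelope_grad x\<close> acts as a subgradient of \<open>h\<close> at
  \<open>Prox lam h x\<close>.\<close>

lemma prox_subgradient:
  assumes b: "h z = ereal b"
  shows "prox_value x + envelope_grad x \<bullet> (z - Prox lam h x) - \<rho> / 2 * (norm (z - Prox lam h x))\<^sup>2 \<le> b"
proof -
  define u where "u = z - Prox lam h x"
  have z: "z - x = u - lam *\<^sub>R envelope_grad x"
    by (simp add: u_def Prox_eq)
  have p: "Prox lam h x - x = - (lam *\<^sub>R envelope_grad x)"
    by (simp add: Prox_eq)
  have "(norm (z - x))\<^sup>2 = (norm u)\<^sup>2 - 2 * lam * (envelope_grad x \<bullet> u)
      + (norm (Prox lam h x - x))\<^sup>2"
    unfolding z p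
    by (simp add: power2_norm_eq_inner inner_simps inner_commute algebra_simps
        power2_eq_square[of lam])
  then have "1 / (2 * lam) * (norm (z - x))\<^sup>2 = 1 / lam / 2 * (norm u)\<^sup>2 - envelope_grad x \<bullet> u
      + 1 / (2 * lam) * (norm (Prox lam h x - x))\<^sup>2"
    using lam_pos by (simp add: field_simps)
  then show ?thesis
    using Prox_set_strong_minimum[OF Prox_in[of x] h_Prox b]
    by (simp add: u_def[symmetric] algebra_simps diff_divide_distrib)
qed

text \<open>The proximal point of \<open>x\<close> serves as a competitor in the problem at
  \<open>y\<close>.\<close>

lemma envelope_upper:
  "envelope y \<le> envelope x + envelope_grad x \<bullet> (y - x) + 1 / (2 * lam) * (norm (y - x))\<^sup>2"
proof -
  have "moreau_envelope lam h y \<le> prox_objective lam h y (Prox lam h x)"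
    unfolding moreau_envelope_def by (rule INF_lower) simp
  then have "envelope y \<le> prox_value x + 1 / (2 * lam) * (norm (Prox lam h x - y))\<^sup>2"
    unfolding moreau_envelope_eq[of y] envelope_eq[of y] prox_objective_def h_Prox by simp
  moreover have "Prox lam h x - y = - (lam *\<^sub>R envelope_grad x + (y - x))"
    by (simp add: Prox_eq)
  then have "(norm (Prox lam h x - y))\<^sup>2 = (norm (Prox lam h x - x))\<^sup>2
      + 2 * lam * (envelope_grad x \<bullet> (y - x)) + (norm (y - x))\<^sup>2"
    by (simp add: Prox_eq power2_norm_eq_inner inner_simps inner_commute algebra_simps
        power2_eq_square[of lam])
  ultimately show ?thesis
    using lam_pos by (simp add: envelope_eq[of x] field_simps)
qed

text \<open>Completing the square in \<open>u\<close>, the displacement between the two proximal points.\<close>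

lemma envelope_lower_quadratic:
  "envelope x + envelope_grad x \<bullet> (y - x) - \<rho> / (1 - lam * \<rho>) / 2 * (norm (y - x))\<^sup>2 \<le> envelope y"
proof -
  define u where "u = Prox lam h y - Prox lam h x"
  define a where "a = y - x"
  define v where "v = envelope_grad x"
  define \<kappa> where "\<kappa> = 1 - lam * \<rho>"
  have \<kappa>: "0 < \<kappa>" and \<rho>: "\<rho> = (1 - \<kappa>) / lam"
    using lam_rho lam_pos by (auto simp: \<kappa>_def)
  \<comment> \<open>\<open>(1 / \<kappa>) *\<^sub>R a\<close> is the critical point in
    \<open>u\<close> of \<open>1 / (2 * lam) * (norm (u - a))\<^sup>2 - \<rho> / 2 * (norm
    u)\<^sup>2\<close>, so the terms linear in \<open>w\<close> cancel.\<close>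
  define w where "w = u - (1 / \<kappa>) *\<^sub>R a"
  have u: "u = w + (1 / \<kappa>) *\<^sub>R a" by (simp add: w_def)
  have Py: "Prox lam h y - y = u - a - lam *\<^sub>R v"
    by (simp add: u_def a_def v_def Prox_eq)
  have Px: "Prox lam h x - x = - (lam *\<^sub>R v)"
    by (simp add: v_def Prox_eq)
  have Py2: "(norm (Prox lam h y - y))\<^sup>2 = (norm (u - a))\<^sup>2 - 2 * lam * (v \<bullet> (u - a))
      + (norm (Prox lam h x - x))\<^sup>2"
    unfolding Py Px
    by (simp add: power2_norm_eq_inner inner_simps inner_commute algebra_simps
        power2_eq_square[of lam] power2_eq_square[of "1 / \<kappa>"])
  have ua: "(norm (u - a))\<^sup>2 = w \<bullet> w + 2 * (1 / \<kappa> - 1) * (w \<bullet> a) + (1 / \<kappa> - 1)\<^sup>2 * (a \<bullet> a)"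
    unfolding u by (simp add: power2_norm_eq_inner inner_simps inner_commute algebra_simps)
       (simp add: power2_eq_square algebra_simps)
  have uu: "(norm u)\<^sup>2 = w \<bullet> w + 2 * (1 / \<kappa>) * (w \<bullet> a) + (1 / \<kappa>)\<^sup>2 * (a \<bullet> a)"
    unfolding u by (simp add: power2_norm_eq_inner inner_simps inner_commute algebra_simps)
       (simp add: power2_eq_square algebra_simps)
  have "1 / (2 * lam) * (norm (u - a))\<^sup>2 - \<rho> / 2 * (norm u)\<^sup>2
      = \<kappa> / (2 * lam) * (w \<bullet> w) - \<rho> / \<kappa> / 2 * (a \<bullet> a)"
    unfolding ua uu \<rho> using \<kappa> lam_pos by (simp add: field_simps power2_eq_square)
  moreover have "0 \<le> \<kappa> / (2 * lam) * (w \<bullet> w)"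
    using \<kappa> lam_pos by simp
  ultimately have 1: "- (\<rho> / \<kappa> / 2 * (norm a)\<^sup>2) \<le> 1 / (2 * lam) * (norm (u - a))\<^sup>2 - \<rho> / 2 * (norm u)\<^sup>2"
    by (simp add: power2_norm_eq_inner)
  have "prox_value x + v \<bullet> u - \<rho> / 2 * (norm u)\<^sup>2 \<le> prox_value y"
    unfolding u_def v_def by (rule prox_subgradient) (rule h_Prox)
  moreover have "1 / (2 * lam) * (norm (Prox lam h y - y))\<^sup>2 =
      1 / (2 * lam) * (norm (u - a))\<^sup>2 - v \<bullet> u + v \<bullet> a
      + 1 / (2 * lam) * (norm (Prox lam h x - x))\<^sup>2"
    unfolding Py2 using lam_pos by (simp add: field_simps inner_simps)
  ultimately show ?thesis
    using 1 unfolding envelope_eq a_def[symmetric] v_def[symmetric] \<kappa>_def[symmetric] by linarith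
qed

text \<open>Hypomonotonicity: the subgradient inequalities at the two proximal points, each tested
  at the other point, are added.\<close>

lemma envelope_grad_monotone:
  "0 \<le> (envelope_grad x - envelope_grad y) \<bullet> (Prox lam h x - Prox lam h y)
     + \<rho> * (norm (Prox lam h x - Prox lam h y))\<^sup>2"
  using prox_subgradient[OF h_Prox, of x y] prox_subgradient[OF h_Prox, of y x]
  by (simp add: inner_simps norm_minus_commute)

text \<open>Rewriting hypomonotonicity in \<open>a\<close> and \<open>w\<close> and applying
  Cauchy-Schwarz gives a quadratic inequality for \<open>norm w\<close>. Its roots are
  \<open>max A B * norm a\<close> and \<open>- (min A B * norm a)\<close>, hence the maximum in the
  constant.\<close>

lemma envelope_grad_lipschitz:
  "norm (envelope_grad x - envelope_grad y) \<le> max (1 / lam) (\<rho> / (1 - lam * \<rho>)) * norm (x - y)"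
proof -
  define a where "a = x - y"
  define w where "w = envelope_grad x - envelope_grad y"
  define \<kappa> where "\<kappa> = 1 - lam * \<rho>"
  define A where "A = 1 / lam"
  define B where "B = \<rho> / \<kappa>"
  have pos: "0 < \<kappa>" "0 \<le> A" "0 \<le> B"
    using lam_rho lam_pos rho_nonneg by (auto simp: \<kappa>_def A_def B_def)
  have P: "Prox lam h x - Prox lam h y = a - lam *\<^sub>R w"
    by (simp add: Prox_eq a_def w_def algebra_simps)
  have "0 \<le> w \<bullet> (a - lam *\<^sub>R w) + \<rho> * (norm (a - lam *\<^sub>R w))\<^sup>2"
    using envelope_grad_monotone[of x y] unfolding P w_def .
  also have "\<dots> = - (lam * \<kappa>) * (w \<bullet> w + (B - A) * (w \<bullet> a) - A * B * (a \<bullet> a))"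
    unfolding A_def B_def using pos(1) lam_pos
    by (simp add: power2_norm_eq_inner inner_simps inner_commute field_simps)
       (simp add: \<kappa>_def algebra_simps)
  finally have "lam * \<kappa> * (w \<bullet> w + (B - A) * (w \<bullet> a) - A * B * (a \<bullet> a)) \<le> 0"
    by simp
  then have "w \<bullet> w + (B - A) * (w \<bullet> a) - A * B * (a \<bullet> a) \<le> 0"
    using pos(1) lam_pos by (simp add: mult_le_0_iff)
  moreover have "\<bar>(B - A) * (w \<bullet> a)\<bar> \<le> \<bar>B - A\<bar> * (norm w * norm a)"
    unfolding abs_mult by (intro mult_left_mono Cauchy_Schwarz_ineq2) auto
  ultimately have "(norm w)\<^sup>2 - \<bar>B - A\<bar> * (norm w * norm a) - A * B * (norm a)\<^sup>2 \<le> 0"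
    unfolding power2_norm_eq_inner by linarith
  moreover have "(norm w)\<^sup>2 - \<bar>B - A\<bar> * (norm w * norm a) - A * B * (norm a)\<^sup>2
      = (norm w - max A B * norm a) * (norm w + min A B * norm a)"
    by (cases "A \<le> B") (auto simp: power2_eq_square algebra_simps)
  ultimately have *: "(norm w - max A B * norm a) * (norm w + min A B * norm a) \<le> 0"
    by simp
  have "norm w \<le> max A B * norm a"
  proof (rule ccontr)
    assume n: "\<not> ?thesis"
    moreover have "0 \<le> max A B * norm a" "0 \<le> min A B * norm a"
      using pos by auto
    ultimately have "0 < (norm w - max A B * norm a) * (norm w + min A B * norm a)"
      by (intro mult_pos_pos) linarith+
    with * show False by simp
  qed
  then show ?thesis
    by (simp add: w_def a_def A_def B_def \<kappa>_def)
qed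

text \<open>Minimality of \<open>z\<close> for its own proximal problem bounds the difference
  quotient of \<open>h\<close> below by \<open>- (1 / (2 * lam) * norm (y - z))\<close>, which
  vanishes at \<open>z\<close>. So 0 is even a regular subgradient, and constant sequences
  suffice.\<close>

lemma Prox_fixed_point_stationary:
  assumes "Prox lam h z = z"
  shows "0 \<in> limiting_subdiff h z"
proof -
  have hz: "h z = ereal (prox_value z)"
    using h_Prox[of z] assms by simp
  have key: "ereal (- (1 / (2 * lam) * norm (y - z))) \<le>
      (h y - h z - ereal (0 \<bullet> (y - z))) / ereal (norm (y - z))" if "y \<noteq> z" for y
  proof (cases "h y")
    case (real b)
    have "prox_objective lam h z z \<le> prox_objective lam h z y"
      using Prox_in[of z] assms by (simp add: Prox_set_def is_arg_min_linorder)
    then have "prox_value z \<le> b + 1 / (2 * lam) * (norm (y - z))\<^sup>2"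
      by (simp add: prox_objective_def hz real)
    then have "- (1 / (2 * lam) * norm (y - z)) \<le> (b - prox_value z) / norm (y - z)"
      using that by (simp add: pos_le_divide_eq power2_eq_square algebra_simps)
    then show ?thesis
      using that by (simp add: hz real)
  next
    case PInf
    then show ?thesis
      using that by (simp add: hz)
  qed simp
  have lim: "((\<lambda>y. ereal (- (1 / (2 * lam) * norm (y - z)))) \<longlongrightarrow> ereal (- (1 / (2 * lam) * norm (z - z)))) (at z)"
    by (intro tendsto_intros)
  have "0 = Liminf (at z) (\<lambda>y. ereal (- (1 / (2 * lam) * norm (y - z))))"
    using lim_imp_Liminf[OF _ lim] by (simp add: zero_ereal_def)
  also have "\<dots> \<le> Liminf (at z) (\<lambda>y. (h y - h z - ereal (0 \<bullet> (y - z))) / ereal (norm (y - z)))"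
    using key by (intro Liminf_mono) (auto simp: eventually_at_filter)
  finally have "0 \<in> regular_subdiff h z"
    by (simp add: regular_subdiff_def ereal_dom_def hz)
  then have "\<exists>y w. y \<longlonglongrightarrow> z \<and> (\<lambda>k. h (y k)) \<longlonglongrightarrow> h z \<and>
      (\<forall>k. w k \<in> regular_subdiff h (y k)) \<and> w \<longlonglongrightarrow> 0"
    by - (rule exI[of _ "\<lambda>_. z"], rule exI[of _ "\<lambda>_. 0"], simp)
  then show ?thesis
    by (simp add: limiting_subdiff_def ereal_dom_def hz)
qed

end

section \<open>Sequences near an accumulation point\<close>

lemma accumulation_point_Suc:
  assumes "accumulation_point x xb"
  shows "accumulation_point (\<lambda>k. x (Suc k)) xb"
proof -
  obtain r where r: "strict_mono r" "(x \<circ> r) \<longlonglongrightarrow> xb"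
    using assms by (auto simp: accumulation_point_def)
  have incr: "r n < r (Suc n)" for n
    using r(1) by (simp add: strict_mono_Suc_iff)
  \<comment> \<open>\<open>r 0\<close> may be 0, where subtracting 1 would truncate; dropping this
    first index makes the shift exact.\<close>
  have pos: "0 < r (Suc n)" for n
    using incr[of n] by simp
  have "r (Suc n) - 1 < r (Suc (Suc n)) - 1" for n
    using incr[of "Suc n"] pos[of n] by simp
  then have "strict_mono (\<lambda>n. r (Suc n) - 1)"
    by (simp add: strict_mono_Suc_iff)
  moreover have "(\<lambda>k. x (Suc k)) \<circ> (\<lambda>n. r (Suc n) - 1) = (\<lambda>n. (x \<circ> r) (Suc n))"
    using pos by (auto simp: fun_eq_iff)
  then have "((\<lambda>k. x (Suc k)) \<circ> (\<lambda>n. r (Suc n) - 1)) \<longlonglongrightarrow> xb"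
    using LIMSEQ_Suc[OF r(2)] by (simp only:)
  ultimately show ?thesis
    unfolding accumulation_point_def by blast
qed

lemma accumulation_point_limit_unique:
  fixes F :: "'a::t2_space \<Rightarrow> 'b::t2_space"
  assumes "accumulation_point x xb" "(\<lambda>k. F (x k)) \<longlonglongrightarrow> l" "isCont F xb"
  shows "F xb = l"
proof -
  obtain r where r: "strict_mono r" "(x \<circ> r) \<longlonglongrightarrow> xb"
    using assms by (auto simp: accumulation_point_def)
  have "(\<lambda>n. F ((x \<circ> r) n)) \<longlonglongrightarrow> F xb"
    by (rule isCont_tendsto_compose[OF assms(3) r(2)])
  moreover have "(\<lambda>n. F ((x \<circ> r) n)) \<longlonglongrightarrow> l"
    using LIMSEQ_subseq_LIMSEQ[OF assms(2) r(1)] by (simp add: o_def)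
  ultimately show ?thesis
    by (rule LIMSEQ_unique)
qed

text \<open>The step bound is available only inside the ball. Past an index where \<open>y\<close>
  is within \<open>r / 2\<close> of \<open>xb\<close> and \<open>u\<close> within
  \<open>r / 2\<close> of its limit, the telescoped path is shorter than \<open>r / 2\<close>, so
  the sequence never leaves and the bound persists.\<close>

lemma trapped_near_accumulation_point:
  fixes y :: "nat \<Rightarrow> 'a::real_normed_vector" and u :: "nat \<Rightarrow> real"
  assumes acc: "accumulation_point y xb" and r: "0 < r"
    and step: "\<And>k. K \<le> k \<Longrightarrow> y k \<in> ball xb r \<Longrightarrow> norm (y (Suc k) - y k) \<le> u k - u (Suc k)"
    and dec: "\<And>k. K \<le> k \<Longrightarrow> u (Suc k) \<le> u k"
    and nonneg: "\<And>k. K \<le> k \<Longrightarrow> 0 \<le> u k"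
  shows "\<forall>\<^sub>F k in sequentially. norm (y k - xb) \<le> u k" "y \<longlonglongrightarrow> xb"
proof -
  have "decseq (\<lambda>k. u (k + K))"
    using dec by (simp add: decseq_Suc_iff)
  then obtain l where l: "(\<lambda>k. u (k + K)) \<longlonglongrightarrow> l" "\<forall>k. l \<le> u (k + K)"
    using decseq_convergent[of "\<lambda>k. u (k + K)" 0] nonneg by auto
  have u_lim: "u \<longlonglongrightarrow> l"
    using l(1) by (rule LIMSEQ_offset)
  have l_le: "l \<le> u k" if "K \<le> k" for k
    using l(2)[rule_format, of "k - K"] that by simp
  have l_nonneg: "0 \<le> l"
    by (rule LIMSEQ_le_const[OF l(1)]) (use nonneg in auto)
  obtain \<sigma> where \<sigma>: "strict_mono \<sigma>" "(y \<circ> \<sigma>) \<longlonglongrightarrow> xb"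
    using acc by (auto simp: accumulation_point_def)
  have "\<forall>\<^sub>F k in sequentially. dist ((y \<circ> \<sigma>) k) xb < r / 2"
    using tendstoD[OF \<sigma>(2), of "r / 2"] r by simp
  moreover have "(u \<circ> \<sigma>) \<longlonglongrightarrow> l"
    by (rule LIMSEQ_subseq_LIMSEQ[OF u_lim \<sigma>(1)])
  then have "\<forall>\<^sub>F k in sequentially. (u \<circ> \<sigma>) k < l + r / 2"
    by (rule order_tendstoD) (use r in simp)
  moreover have "\<forall>\<^sub>F k in sequentially. K \<le> k"
    by (rule eventually_ge_at_top)
  ultimately have "\<forall>\<^sub>F k in sequentially. dist (y (\<sigma> k)) xb < r / 2 \<and> u (\<sigma> k) < l + r / 2 \<and> K \<le> k"
    by eventually_elim simp
  then obtain j where j: "dist (y (\<sigma> j)) xb < r / 2" "u (\<sigma> j) < l + r / 2" "K \<le> j"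
    by (auto simp: eventually_sequentially)
  define N where "N = \<sigma> j"
  have KN: "K \<le> N"
    using j(3) seq_suble[OF \<sigma>(1), of j] by (simp add: N_def)
  have trapped: "norm (y n - y N) \<le> u N - u n \<and> y n \<in> ball xb r" if "N \<le> n" for n
    using that
  proof (induction n rule: dec_induct)
    case base
    then show ?case using j(1) r by (simp add: N_def dist_commute)
  next
    case (step n)
    have "norm (y (Suc n) - y N) \<le> norm (y (Suc n) - y n) + norm (y n - y N)"
      using norm_triangle_ineq[of "y (Suc n) - y n" "y n - y N"] by simp
    then have 1: "norm (y (Suc n) - y N) \<le> u N - u (Suc n)"
      using step assms(3)[of n] KN by simp
    have "dist xb (y (Suc n)) \<le> dist xb (y N) + dist (y N) (y (Suc n))"
      by (rule dist_triangle)
    also have "\<dots> < r / 2 + r / 2"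
      using 1 j(1,2) l_le[of "Suc n"] KN step by (simp add: N_def dist_norm norm_minus_commute)
    finally show ?case using 1 by simp
  qed
  have tail: "norm (y n - y m) \<le> u m - u n" if "N \<le> m" "m \<le> n" for m n
    using that(2)
  proof (induction n rule: dec_induct)
    case (step n)
    have "norm (y (Suc n) - y m) \<le> norm (y (Suc n) - y n) + norm (y n - y m)"
      using norm_triangle_ineq[of "y (Suc n) - y n" "y n - y m"] by simp
    then show ?case
      using step assms(3)[of n] KN that trapped[of n] by simp
  qed simp
  \<comment> \<open>\<open>xb\<close> is known only as the limit along \<open>\<sigma>\<close>, so
    the tail estimate is used at \<open>\<sigma> k\<close> and passed to the limit.\<close>
  have bound: "norm (y m - xb) \<le> u m - l" if m: "N \<le> m" for m
  proof (rule tendsto_upperbound)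
    show "(\<lambda>k. norm (y m - (y \<circ> \<sigma>) k)) \<longlonglongrightarrow> norm (y m - xb)"
      by (intro tendsto_intros \<sigma>)
    show "\<forall>\<^sub>F k in sequentially. norm (y m - (y \<circ> \<sigma>) k) \<le> u m - l"
      using eventually_ge_at_top[of m]
    proof eventually_elim
      case (elim k)
      then have "m \<le> \<sigma> k"
        using seq_suble[OF \<sigma>(1), of k] by simp
      then show ?case
        using tail[OF m, of "\<sigma> k"] l_le[of "\<sigma> k"] m KN by (simp add: norm_minus_commute)
    qed
  qed simp
  show "\<forall>\<^sub>F k in sequentially. norm (y k - xb) \<le> u k"
    using eventually_ge_at_top[of N] by eventually_elim (use bound l_nonneg order_trans in fastforce)
  \<comment> \<open>Convergence rests on the sharper bound \<open>u k - l\<close>, as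
    \<open>u\<close> itself may have a positive limit.\<close>
  have "(\<lambda>k. u k - l) \<longlonglongrightarrow> 0"
    using tendsto_diff[OF u_lim tendsto_const[of l]] by simp
  then have "(\<lambda>k. y k - xb) \<longlonglongrightarrow> 0"
    by (rule Lim_null_comparison[rotated])
       (use eventually_ge_at_top[of N] in eventually_elim, use bound in auto)
  then show "y \<longlonglongrightarrow> xb"
    by (simp add: LIM_zero_iff)
qed

section \<open>Decay rates of scalar recursions\<close>

lemma geometric_decay:
  fixes t :: "nat \<Rightarrow> real"
  assumes "0 < m" and dec: "\<And>k. K \<le> k \<Longrightarrow> t (Suc k) \<le> m * t k" and "K \<le> k"
  shows "t k \<le> t K / m ^ K * m ^ k"
  using \<open>K \<le> k\<close>
proof (induction k rule: dec_induct)
  case base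
  then show ?case using \<open>0 < m\<close> by simp
next
  case (step k)
  have "t (Suc k) \<le> m * t k" using dec step by simp
  also have "\<dots> \<le> m * (t K / m ^ K * m ^ k)"
    using step \<open>0 < m\<close> by (intro mult_left_mono) auto
  finally show ?case by (simp add: mult_ac)
qed

text \<open>The quantity \<open>t k powr (- \<alpha>)\<close> grows at least linearly, since
  \<open>(1 - v) powr (- \<alpha>) \<ge> 1 + \<alpha> v\<close>.\<close>

lemma polynomial_decay:
  fixes t :: "nat \<Rightarrow> real"
  assumes \<alpha>: "0 < \<alpha>" and c: "0 < c"
    and pos: "\<And>k. K \<le> k \<Longrightarrow> 0 < t k"
    and dec: "\<And>k. K \<le> k \<Longrightarrow> t (Suc k) \<le> t k - c * t k powr (1 + \<alpha>)"
  shows "\<exists>C>0. \<forall>\<^sub>F k in sequentially. t k \<le> C * real (Suc k) powr (- 1 / \<alpha>)"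
proof -
  have incr: "t k powr (- \<alpha>) + \<alpha> * c \<le> t (Suc k) powr (- \<alpha>)" if k: "K \<le> k" for k
  proof -
    define v where "v = c * t k powr \<alpha>"
    have t: "t (Suc k) \<le> t k * (1 - v)"
      using dec[OF k] pos[OF k] by (simp add: v_def powr_add algebra_simps)
    \<comment> \<open>Positivity of the next term forces \<open>v < 1\<close>, so
      \<open>ln (1 - v)\<close> is meaningful.\<close>
    then have "0 < t k * (1 - v)"
      using pos[of "Suc k"] k by simp
    then have v1: "v < 1"
      using pos[OF k] by (simp add: zero_less_mult_iff)
    have "1 + \<alpha> * v \<le> exp (\<alpha> * v)"
      by (rule exp_ge_add_one_self)
    also have "\<alpha> * v \<le> - \<alpha> * ln (1 - v)"
      using mult_left_mono[of v "- ln (1 - v)" \<alpha>] ln_le_minus_one[of "1 - v"] v1 \<alpha> by simp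
    then have "exp (\<alpha> * v) \<le> (1 - v) powr (- \<alpha>)"
      using v1 by (simp add: powr_def)
    finally have "t k powr (- \<alpha>) * (1 + \<alpha> * v) \<le> t k powr (- \<alpha>) * (1 - v) powr (- \<alpha>)"
      by (intro mult_left_mono) auto
    also have "\<dots> = (t k * (1 - v)) powr (- \<alpha>)"
      using pos[OF k] v1 by (simp add: powr_mult)
    also have "\<dots> \<le> t (Suc k) powr (- \<alpha>)"
      using t pos[of "Suc k"] k \<alpha> by (intro powr_mono2') auto
    finally have "t k powr (- \<alpha>) * (1 + \<alpha> * v) \<le> t (Suc k) powr (- \<alpha>)" .
    moreover have "t k powr (- \<alpha>) * (1 + \<alpha> * v) = t k powr (- \<alpha>) + \<alpha> * c"
      using pos[OF k] by (simp add: v_def powr_minus field_simps)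
    ultimately show ?thesis by simp
  qed
  have lin: "\<alpha> * c * (real k - real K) \<le> t k powr (- \<alpha>)" if "K \<le> k" for k
    using that
  proof (induction k rule: dec_induct)
    case (step k)
    then show ?case using incr[of k] by (simp add: algebra_simps)
  qed simp
  define C where "C = (\<alpha> * c / 2) powr (- 1 / \<alpha>)"
  \<comment> \<open>From \<open>2 * K + 1\<close> on, \<open>k - K\<close> is at least half of
    \<open>k + 1\<close>; this costs the factor 2 in \<open>C\<close>.\<close>
  have "t k \<le> C * real (Suc k) powr (- 1 / \<alpha>)" if k: "2 * K + 1 \<le> k" for k
  proof -
    have pk: "0 < t k" using pos k by simp
    have "\<alpha> * c / 2 * real (Suc k) = \<alpha> * c * (real (Suc k) / 2)"
      by simp
    also have "\<dots> \<le> \<alpha> * c * (real k - real K)"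
      using k \<alpha> c by (intro mult_left_mono) auto
    also have "\<dots> \<le> t k powr (- \<alpha>)"
      using lin k by simp
    finally have "(t k powr (- \<alpha>)) powr (- 1 / \<alpha>) \<le> (\<alpha> * c / 2 * real (Suc k)) powr (- 1 / \<alpha>)"
      using \<alpha> c by (intro powr_mono2') auto
    moreover have "(t k powr (- \<alpha>)) powr (- 1 / \<alpha>) = t k"
      using \<alpha> pk by (simp add: powr_powr)
    moreover have "(\<alpha> * c / 2 * real (Suc k)) powr (- 1 / \<alpha>) = C * real (Suc k) powr (- 1 / \<alpha>)"
      unfolding C_def by (rule powr_mult)
    ultimately show ?thesis by simp
  qed
  moreover have "0 < C"
    using \<alpha> c by (simp add: C_def)
  ultimately show ?thesis
    unfolding eventually_sequentially by blast
qed

text \<open>Extracts a working form: a real \<open>\<eta>\<close> below the possibly infinite range,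
  a ball inside the neighbourhood, and concavity as a tangent inequality. The latter yields both the
  monotonicity of the slopes and the decrease of the desingularized gaps.\<close>

lemma PLK_withE:
  assumes "PLK_with f xb \<phi>"
  obtains \<eta> r where "0 < \<eta>" "0 < r"
    "\<And>u v. 0 < u \<Longrightarrow> u < \<eta> \<Longrightarrow> 0 < v \<Longrightarrow> v < \<eta> \<Longrightarrow> \<phi> u \<le> \<phi> v + deriv \<phi> v * (u - v)"
    "\<And>v. 0 < v \<Longrightarrow> v < \<eta> \<Longrightarrow> 0 < deriv \<phi> v"
    "\<And>v. 0 < v \<Longrightarrow> v < \<eta> \<Longrightarrow> 0 \<le> \<phi> v"
    "\<And>y. y \<in> ball xb r \<Longrightarrow> f xb < f y \<Longrightarrow> f y < f xb + \<eta> \<Longrightarrow>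
       1 \<le> deriv \<phi> (f y - f xb) * norm (grad f y)"
proof -
  obtain \<eta>' U where \<eta>': "0 < (\<eta>'::ereal)" and U: "open U" "xb \<in> U"
    and conc: "concave_on {t. 0 \<le> t \<and> ereal t < \<eta>'} \<phi>"
    and nonneg: "\<And>t. 0 \<le> t \<Longrightarrow> ereal t < \<eta>' \<Longrightarrow> 0 \<le> \<phi> t"
    and C1: "\<phi> C1_differentiable_on {t. 0 < t \<and> ereal t < \<eta>'}"
    and pos: "\<And>t. 0 < t \<Longrightarrow> ereal t < \<eta>' \<Longrightarrow> 0 < deriv \<phi> t"
    and plk: "\<And>x. x \<in> U \<Longrightarrow> f xb < f x \<Longrightarrow> ereal (f x) < ereal (f xb) + \<eta>' \<Longrightarrow>
        1 \<le> deriv \<phi> (f x - f xb) * norm (grad f x)"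
    using assms unfolding PLK_with_def by blast
  obtain \<eta> where \<eta>: "0 < \<eta>" "ereal \<eta> < \<eta>'"
    using ereal_dense2[OF \<eta>'] by (auto simp: zero_ereal_def)
  obtain r where r: "0 < r" "ball xb r \<subseteq> U"
    using U open_contains_ball by blast
  have less: "ereal t < \<eta>'" if "t < \<eta>" for t
    using that less_trans[of "ereal t" "ereal \<eta>", OF _ \<eta>(2)] by simp
  have tangent: "\<phi> u \<le> \<phi> v + deriv \<phi> v * (u - v)"
    if uv: "0 < u" "u < \<eta>" "0 < v" "v < \<eta>" for u v
  proof -
    have "{0<..<\<eta>} \<subseteq> {t. 0 \<le> t \<and> ereal t < \<eta>'}"
      using less by auto
    then have "convex_on {0<..<\<eta>} (\<lambda>t. - \<phi> t)"
      using conc convex_on_subset unfolding concave_on_def by blast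
    moreover obtain D where "(\<phi> has_vector_derivative D) (at v)"
      using C1 uv(3) less[OF uv(4)] unfolding C1_differentiable_on_def by blast
    then have "(\<phi> has_field_derivative D) (at v)"
      by (simp add: has_real_derivative_iff_has_vector_derivative)
    then have "(\<phi> has_field_derivative deriv \<phi> v) (at v)"
      using DERIV_imp_deriv[of \<phi> D v] by (simp only:)
    then have "((\<lambda>t. - \<phi> t) has_field_derivative - deriv \<phi> v) (at v within {0<..<\<eta>})"
      by (rule has_field_derivative_at_within[OF DERIV_minus])
    ultimately have "- deriv \<phi> v * (u - v) \<le> - \<phi> u - - \<phi> v"
      using uv by (intro convex_on_imp_above_tangent[where A = "{0<..<\<eta>}"])
        (simp_all add: interior_open)
    then show ?thesis by simp
  qed
  show thesis
  proof (rule that[OF \<eta>(1) r(1) tangent])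
    fix y assume y: "y \<in> ball xb r" "f xb < f y" "f y < f xb + \<eta>"
    have "ereal (f y) < ereal (f xb) + \<eta>'"
      using less[of "f y - f xb"] y(3) by (cases \<eta>') auto
    then show "1 \<le> deriv \<phi> (f y - f xb) * norm (grad f y)"
      using plk y r(2) by blast
  qed (use pos nonneg less in auto)
qed

section \<open>Inexact gradient method with momentum\<close>

text \<open>The index is shifted: \<open>\<beta> k\<close>, \<open>\<gamma> k\<close> and \<open>g k\<close> belong to the step from \<open>x (k + 1)\<close> to \<open>x (k + 2)\<close>.\<close>

locale inexact_momentum_gradient =
  fixes f :: "'a::real_inner \<Rightarrow> real" and G :: "'a \<Rightarrow> 'a"
    and L \<tau> \<nu> \<beta>b \<delta> c :: real and \<beta> \<gamma> :: "nat \<Rightarrow> real" and x g :: "nat \<Rightarrow> 'a"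
  assumes quadratic_bound: "\<And>y z. \<bar>f z - f y - G y \<bullet> (z - y)\<bar> \<le> L / 2 * (norm (z - y))\<^sup>2"
    and lipschitz: "\<And>y z. norm (G y - G z) \<le> L * norm (y - z)"
    and lower_bound: "\<And>y. c \<le> f y"
    and L_pos: "0 < L" and \<tau>_pos: "0 < \<tau>" and \<nu>_pos: "0 < \<nu>"
    and \<beta>_nonneg: "\<And>k. 0 \<le> \<beta> k" and \<beta>_le: "\<And>k. \<beta> k \<le> \<beta>b"
    and \<gamma>_nonneg: "\<And>k. 0 \<le> \<gamma> k" and \<delta>_le: "\<And>k. \<bar>\<beta> k - \<gamma> k\<bar> \<le> \<delta>"
    and step_size: "L * \<tau> < 1 - \<nu>"
    and momentum_size: "2 * L * \<tau> * \<delta> + (L * \<tau> + 1) * \<beta>b\<^sup>2 < 1 - \<nu>"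
    and inexact: "\<And>k. norm (G (x (Suc k) + \<gamma> k *\<^sub>R (x (Suc k) - x k)) - g k) \<le> \<nu> * norm (g k)"
    and iteration: "\<And>k. x (Suc (Suc k)) = x (Suc k) + \<beta> k *\<^sub>R (x (Suc k) - x k) - \<tau> *\<^sub>R g k"
    and g_nonzero: "\<And>k. g k \<noteq> 0"
begin

definition d :: "nat \<Rightarrow> 'a" where "d k = x (Suc k) - x k"

text \<open>Chosen so that \<open>2 * \<tau> * A\<close> is the coefficient of
  \<open>(norm (d (Suc k)))\<^sup>2\<close> in \<open>one_step\<close>, which is thereby absorbed
  into \<open>H (Suc k)\<close>.\<close>

definition A :: real where "A = (1 - \<nu> - L * \<tau> * \<delta>) / (2 * \<tau>)"

definition H :: "nat \<Rightarrow> real" where "H k = f (x (Suc k)) + A * (norm (d k))\<^sup>2"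

definition s :: "nat \<Rightarrow> real" where "s k = norm (d k) + norm (g k)"

text \<open>The three summands dominate the coefficients met in \<open>norm_d_le\<close> and
  \<open>norm_G_le\<close>, so one constant serves both.\<close>

definition \<kappa> :: real where "\<kappa> = 1 + (1 + \<nu>) + L * (\<beta>b + \<delta>)"

section \<open>Regularity of the objective\<close>

lemma GDERIV_G: "GDERIV f y :> G y"
  unfolding gderiv_def has_derivative_at
proof
  show "bounded_linear (\<lambda>h. h \<bullet> G y)"
    by (rule bounded_linear_inner_left)
  have lim: "(\<lambda>h::'a. L / 2 * norm h) \<midarrow>0\<rightarrow> 0"
    by (rule tendsto_mult_right_zero[OF tendsto_norm_zero[OF tendsto_ident_at]])
  have "norm (norm (f (y + h) - f y - h \<bullet> G y) / norm h) \<le> L / 2 * norm h" for h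
    using quadratic_bound[of "y + h" y]
    by (cases "h = 0") (auto simp: field_simps power2_eq_square inner_commute)
  then show "(\<lambda>h. norm (f (y + h) - f y - h \<bullet> G y) / norm h) \<midarrow>0\<rightarrow> 0"
    by (intro Lim_null_comparison[OF _ lim] always_eventually) auto
qed

lemma grad_eq: "grad f y = G y"
proof -
  have "D = G y" if "GDERIV f y :> D" for D
  proof -
    have "(\<lambda>h. h \<bullet> D) = (\<lambda>h. h \<bullet> G y)"
      using that GDERIV_G[of y] unfolding gderiv_def by (rule has_derivative_unique)
    \<comment> \<open>Both derivatives are evaluated at the difference of their representing
      vectors.\<close>
    then have "(D - G y) \<bullet> D = (D - G y) \<bullet> G y"
      by (rule fun_cong)
    then have "(D - G y) \<bullet> (D - G y) = 0"
      by (simp only: inner_diff_right)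
    then show ?thesis by simp
  qed
  then show ?thesis
    unfolding grad_def using GDERIV_G by blast
qed

lemma isCont_f: "isCont f y"
  using GDERIV_G has_derivative_continuous unfolding gderiv_def by blast

lemma isCont_G: "isCont G y"
proof -
  have "(\<lambda>z. z - y) \<midarrow>y\<rightarrow> 0"
    by (rule LIM_zero[OF tendsto_ident_at])
  then have "(\<lambda>z. L * norm (z - y)) \<midarrow>y\<rightarrow> 0"
    by (intro tendsto_mult_right_zero tendsto_norm_zero)
  then have "(\<lambda>z. G z - G y) \<midarrow>y\<rightarrow> 0"
    by (rule Lim_null_comparison[rotated]) (simp add: lipschitz)
  then show ?thesis
    by (simp add: isCont_def LIM_zero_iff)
qed

lemma \<delta>_nonneg: "0 \<le> \<delta>"
  using \<delta>_le[of 0] by simp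

lemma \<beta>b_nonneg: "0 \<le> \<beta>b"
  using \<beta>_nonneg[of 0] \<beta>_le[of 0] by simp

section \<open>Descent of the Lyapunov values\<close>

text \<open>Old and new iterates are both compared with the inertial point \<open>I\<close>.
  Replacing \<open>G I\<close> by \<open>g k\<close> costs the extrapolation mismatch (through
  \<open>\<delta>\<close>) and the inexactness (through \<open>\<nu>\<close>); the resulting
  products are split by \<open>2 * a * b \<le> a\<^sup>2 + b\<^sup>2\<close>.\<close>

lemma one_step:
  "2 * \<tau> * (f (x (Suc (Suc k))) - f (x (Suc k))) \<le>
     ((L * \<tau> + 1) * \<beta>b\<^sup>2 + L * \<tau> * \<delta>) * (norm (d k))\<^sup>2
     - (1 - \<nu> - L * \<tau>) * (\<tau> * norm (g k))\<^sup>2 - (1 - \<nu> - L * \<tau> * \<delta>) * (norm (d (Suc k)))\<^sup>2"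
proof -
  define X where "X = x (Suc k)"
  define Y where "Y = x (Suc (Suc k))"
  define I where "I = X + \<beta> k *\<^sub>R d k"
  define N where "N = norm (d k)"
  define M where "M = \<tau> * norm (g k)"
  define N' where "N' = norm (d (Suc k))"
  have YI: "Y - I = - (\<tau> *\<^sub>R g k)" and XI: "X - I = - (\<beta> k *\<^sub>R d k)"
    by (simp_all add: Y_def I_def X_def d_def iteration)
  have D': "d (Suc k) = Y - X"
    by (simp add: d_def X_def Y_def)
  have D'': "d (Suc k) = \<beta> k *\<^sub>R d k - \<tau> *\<^sub>R g k"
    by (simp add: d_def iteration)
  have nYI: "norm (Y - I) = M" and nXI: "norm (X - I) = \<beta> k * N"
    unfolding YI XI using \<tau>_pos \<beta>_nonneg[of k] by (simp_all add: M_def N_def)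
  have "f Y - f I \<le> G I \<bullet> (Y - I) + L / 2 * M\<^sup>2"
    using quadratic_bound[of Y I] unfolding nYI by linarith
  moreover have "f I - f X \<le> - (G I \<bullet> (X - I)) + L / 2 * (\<beta> k * N)\<^sup>2"
    using quadratic_bound[of X I] unfolding nXI by linarith
  ultimately have 1: "f Y - f X \<le> G I \<bullet> d (Suc k) + L / 2 * M\<^sup>2 + L / 2 * (\<beta> k * N)\<^sup>2"
    unfolding D' by (simp add: inner_simps)
  have "norm (G I - g k) \<le> norm (G I - G (X + \<gamma> k *\<^sub>R d k)) + norm (G (X + \<gamma> k *\<^sub>R d k) - g k)"
    using norm_triangle_ineq[of "G I - G (X + \<gamma> k *\<^sub>R d k)" "G (X + \<gamma> k *\<^sub>R d k) - g k"] by simp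
  also have "\<dots> \<le> L * (\<delta> * N) + \<nu> * norm (g k)"
  proof (rule add_mono)
    have "I - (X + \<gamma> k *\<^sub>R d k) = (\<beta> k - \<gamma> k) *\<^sub>R d k"
      by (simp add: I_def algebra_simps)
    then have "norm (I - (X + \<gamma> k *\<^sub>R d k)) \<le> \<delta> * N"
      using \<delta>_le[of k] by (simp add: N_def mult_right_mono)
    then show "norm (G I - G (X + \<gamma> k *\<^sub>R d k)) \<le> L * (\<delta> * N)"
      using lipschitz[of I "X + \<gamma> k *\<^sub>R d k"] L_pos
      by (meson mult_left_mono less_imp_le order_trans)
    show "norm (G (X + \<gamma> k *\<^sub>R d k) - g k) \<le> \<nu> * norm (g k)"
      using inexact[of k] by (simp add: X_def d_def)
  qed
  finally have E: "norm (G I - g k) \<le> L * (\<delta> * N) + \<nu> * norm (g k)" .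
  have "(G I - g k) \<bullet> d (Suc k) \<le> norm (G I - g k) * N'"
    unfolding N'_def by (rule norm_cauchy_schwarz)
  also have "\<dots> \<le> (L * (\<delta> * N) + \<nu> * norm (g k)) * N'"
    using E by (intro mult_right_mono) (auto simp: N'_def)
  finally have "2 * \<tau> * (G I \<bullet> d (Suc k)) \<le>
      2 * \<tau> * (g k \<bullet> d (Suc k)) + 2 * \<tau> * ((L * (\<delta> * N) + \<nu> * norm (g k)) * N')"
    using \<tau>_pos by (simp add: inner_simps flip: distrib_left)
  also have "2 * \<tau> * ((L * (\<delta> * N) + \<nu> * norm (g k)) * N') = L * \<tau> * \<delta> * (2 * N * N') + \<nu> * (2 * M * N')"
    by (simp add: M_def algebra_simps)
  also have "\<dots> \<le> L * \<tau> * \<delta> * (N\<^sup>2 + N'\<^sup>2) + \<nu> * (M\<^sup>2 + N'\<^sup>2)"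
    using L_pos \<tau>_pos \<nu>_pos \<delta>_nonneg by (intro add_mono mult_left_mono sum_squares_bound) auto
  \<comment> \<open>Polarization: \<open>\<beta> k *\<^sub>R d k\<close> is the sum of
    \<open>\<tau> *\<^sub>R g k\<close> and \<open>d (Suc k)\<close>.\<close>
  also have "2 * \<tau> * (g k \<bullet> d (Suc k)) = (\<beta> k * N)\<^sup>2 - M\<^sup>2 - N'\<^sup>2"
  proof -
    have "(norm (\<beta> k *\<^sub>R d k))\<^sup>2 = (norm (\<tau> *\<^sub>R g k + d (Suc k)))\<^sup>2"
      by (simp add: D'')
    also have "\<dots> = (norm (\<tau> *\<^sub>R g k))\<^sup>2 + 2 * \<tau> * (g k \<bullet> d (Suc k)) + (norm (d (Suc k)))\<^sup>2"
      unfolding power2_norm_eq_inner by (simp add: inner_simps inner_commute)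
    finally show ?thesis
      using \<tau>_pos \<beta>_nonneg[of k] by (simp add: N_def M_def N'_def)
  qed
  finally have 2: "2 * \<tau> * (G I \<bullet> d (Suc k)) \<le>
      (\<beta> k * N)\<^sup>2 - M\<^sup>2 - N'\<^sup>2 + (L * \<tau> * \<delta> * (N\<^sup>2 + N'\<^sup>2) + \<nu> * (M\<^sup>2 + N'\<^sup>2))"
    by simp
  have "2 * \<tau> * (f Y - f X) \<le> 2 * \<tau> * (G I \<bullet> d (Suc k) + L / 2 * M\<^sup>2 + L / 2 * (\<beta> k * N)\<^sup>2)"
    using 1 \<tau>_pos by (intro mult_left_mono) auto
  also have "\<dots> = 2 * \<tau> * (G I \<bullet> d (Suc k)) + L * \<tau> * M\<^sup>2 + L * \<tau> * (\<beta> k * N)\<^sup>2"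
    by (simp add: algebra_simps)
  also have "\<dots> \<le> (L * \<tau> + 1) * (\<beta> k * N)\<^sup>2 + L * \<tau> * \<delta> * N\<^sup>2
      - (1 - \<nu> - L * \<tau>) * M\<^sup>2 - (1 - \<nu> - L * \<tau> * \<delta>) * N'\<^sup>2"
    using 2 by (simp add: algebra_simps)
  also have "(L * \<tau> + 1) * (\<beta> k * N)\<^sup>2 \<le> (L * \<tau> + 1) * (\<beta>b * N)\<^sup>2"
    using \<beta>_le[of k] \<beta>_nonneg[of k] L_pos \<tau>_pos
    by (intro mult_left_mono power_mono mult_right_mono) (auto simp: N_def)
  finally show ?thesis
    by (simp add: X_def Y_def N_def M_def N'_def algebra_simps power_mult_distrib)
qed

lemma A_pos: "0 < A"
proof -
  have "0 \<le> L * \<tau> * \<delta>" "0 \<le> (L * \<tau> + 1) * \<beta>b\<^sup>2"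
    using L_pos \<tau>_pos \<delta>_nonneg by auto
  then have "0 < 1 - \<nu> - L * \<tau> * \<delta>"
    using momentum_size by simp
  then show ?thesis
    using \<tau>_pos by (simp add: A_def)
qed

text \<open>After the choice of \<open>A\<close>, the remaining coefficients of
  \<open>(norm (d k))\<^sup>2\<close> and \<open>(norm (g k))\<^sup>2\<close> are \<open>B\<close>
  and \<open>C\<close>, positive by \<open>momentum_size\<close> and \<open>step_size\<close>
  respectively.\<close>

lemma descent: "\<exists>a>0. \<forall>k. a * (s k)\<^sup>2 \<le> H k - H (Suc k)"
proof -
  define B where "B = (1 - \<nu>) - (2 * L * \<tau> * \<delta> + (L * \<tau> + 1) * \<beta>b\<^sup>2)"
  define C where "C = (1 - \<nu> - L * \<tau>) * \<tau>\<^sup>2"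
  define m where "m = min B C"
  have m_pos: "0 < m"
    using step_size momentum_size \<tau>_pos by (simp add: m_def B_def C_def)
  have "m * (s k)\<^sup>2 \<le> 4 * \<tau> * (H k - H (Suc k))" for k
  proof -
    have "(norm (d k) + norm (g k))\<^sup>2 \<le> 2 * ((norm (d k))\<^sup>2 + (norm (g k))\<^sup>2)"
      using sum_squares_bound[of "norm (d k)" "norm (g k)"] by (simp add: power2_sum)
    then have "m * (s k)\<^sup>2 \<le> m * (2 * ((norm (d k))\<^sup>2 + (norm (g k))\<^sup>2))"
      unfolding s_def using m_pos by (intro mult_left_mono) auto
    also have "\<dots> = 2 * (m * (norm (d k))\<^sup>2 + m * (norm (g k))\<^sup>2)"
      by (simp add: algebra_simps)
    also have "\<dots> \<le> 2 * (B * (norm (d k))\<^sup>2 + C * (norm (g k))\<^sup>2)"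
      by (intro mult_left_mono add_mono mult_right_mono) (auto simp: m_def)
    also have "B * (norm (d k))\<^sup>2 + C * (norm (g k))\<^sup>2 \<le> 2 * \<tau> * (H k - H (Suc k))"
    proof -
      have "2 * \<tau> * A = 1 - \<nu> - L * \<tau> * \<delta>"
        using \<tau>_pos by (simp add: A_def)
      then have "2 * \<tau> * (H k - H (Suc k)) = - (2 * \<tau> * (f (x (Suc (Suc k))) - f (x (Suc k))))
          + (1 - \<nu> - L * \<tau> * \<delta>) * (norm (d k))\<^sup>2 - (1 - \<nu> - L * \<tau> * \<delta>) * (norm (d (Suc k)))\<^sup>2"
        unfolding H_def by algebra
      then show ?thesis
        using one_step[of k] by (simp add: B_def C_def power_mult_distrib algebra_simps)
    qed
    finally show ?thesis by simp
  qed
  then show ?thesis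
    using m_pos \<tau>_pos by (intro exI[of _ "m / (4 * \<tau>)"]) (auto simp: field_simps)
qed

lemma s_pos: "0 < s k"
  using g_nonzero[of k] by (simp add: s_def add_nonneg_pos)

text \<open>Strictness comes from \<open>g_nonzero\<close>. It keeps the gaps
  \<open>H k - f xb\<close> positive, so slopes and negative powers can be evaluated there.\<close>

lemma H_decreasing: "H (Suc k) < H k"
proof -
  obtain a where "0 < a" "a * (s k)\<^sup>2 \<le> H k - H (Suc k)"
    using descent by blast
  moreover have "0 < a * (s k)\<^sup>2"
    using s_pos[of k] calculation by simp
  ultimately show ?thesis by linarith
qed

lemma \<kappa>_pos: "0 < \<kappa>"
proof -
  have "0 \<le> L * (\<beta>b + \<delta>)"
    using L_pos \<beta>b_nonneg \<delta>_nonneg by simp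
  then show ?thesis
    using \<nu>_pos by (simp add: \<kappa>_def)
qed

lemma norm_d_le: "norm (d k) \<le> \<kappa> * s k"
proof -
  have "0 \<le> L * (\<beta>b + \<delta>)"
    using L_pos \<beta>b_nonneg \<delta>_nonneg by simp
  then have "1 * norm (d k) \<le> \<kappa> * s k"
    using \<nu>_pos by (intro mult_mono) (auto simp: \<kappa>_def s_def)
  then show ?thesis by simp
qed

text \<open>A detour through the extrapolated point, where \<open>g k\<close> approximates the
  gradient; \<open>\<gamma> k \<le> \<beta>b + \<delta>\<close> controls its distance.\<close>

lemma norm_G_le: "norm (G (x (Suc k))) \<le> \<kappa> * s k"
proof -
  let ?z = "x (Suc k) + \<gamma> k *\<^sub>R d k"
  have "norm (G (x (Suc k))) \<le> norm (G (x (Suc k)) - G ?z) + norm (G ?z - g k) + norm (g k)"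
    using norm_triangle_ineq[of "G (x (Suc k)) - G ?z" "G ?z - g k + g k"]
      norm_triangle_ineq[of "G ?z - g k" "g k"] by simp
  moreover have "norm (G ?z - g k) \<le> \<nu> * norm (g k)"
    using inexact[of k] by (simp add: d_def)
  moreover have "norm (G (x (Suc k)) - G ?z) \<le> L * (\<beta>b + \<delta>) * norm (d k)"
  proof -
    have "norm (G (x (Suc k)) - G ?z) \<le> L * (\<gamma> k * norm (d k))"
      using lipschitz[of "x (Suc k)" ?z] \<gamma>_nonneg[of k] by simp
    also have "\<dots> \<le> L * ((\<beta>b + \<delta>) * norm (d k))"
      using L_pos \<beta>_le[of k] \<delta>_le[of k] by (intro mult_left_mono mult_right_mono) auto
    finally show ?thesis by (simp add: mult.assoc)
  qed
  ultimately have "norm (G (x (Suc k))) \<le> L * (\<beta>b + \<delta>) * norm (d k) + (1 + \<nu>) * norm (g k)"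
    by (simp add: algebra_simps)
  also have "\<dots> \<le> \<kappa> * norm (d k) + \<kappa> * norm (g k)"
    using L_pos \<beta>b_nonneg \<delta>_nonneg \<nu>_pos
    by (intro add_mono mult_right_mono) (auto simp: \<kappa>_def)
  finally show ?thesis by (simp add: s_def algebra_simps)
qed

lemma norm_d_Suc_le: "norm (d (Suc k)) \<le> (\<beta>b + \<tau>) * s k"
proof -
  have "d (Suc k) = \<beta> k *\<^sub>R d k - \<tau> *\<^sub>R g k"
    by (simp add: d_def iteration)
  then have "norm (d (Suc k)) \<le> \<beta> k * norm (d k) + \<tau> * norm (g k)"
    using norm_triangle_ineq4[of "\<beta> k *\<^sub>R d k" "\<tau> *\<^sub>R g k"] \<beta>_nonneg[of k] \<tau>_pos by simp
  also have "\<dots> \<le> (\<beta>b + \<tau>) * norm (d k) + (\<beta>b + \<tau>) * norm (g k)"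
    using \<beta>_le[of k] \<tau>_pos \<beta>b_nonneg by (intro add_mono mult_right_mono) auto
  finally show ?thesis by (simp add: s_def algebra_simps)
qed

lemma H_convergent: "\<exists>l. H \<longlonglongrightarrow> l"
proof -
  have "c \<le> H k" for k
    using lower_bound[of "x (Suc k)"] A_pos by (simp add: H_def add_increasing2)
  moreover have "decseq H"
    using H_decreasing by (simp add: decseq_Suc_iff less_imp_le)
  ultimately show ?thesis
    using decseq_convergent[of H c] by blast
qed

text \<open>The squares are dominated by successive differences of a convergent sequence.\<close>

lemma s_tendsto_0: "s \<longlonglongrightarrow> 0"
proof -
  obtain a where a: "0 < a" "\<And>k. a * (s k)\<^sup>2 \<le> H k - H (Suc k)"
    using descent by blast
  obtain l where l: "H \<longlonglongrightarrow> l"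
    using H_convergent by blast
  have "(\<lambda>k. (H k - H (Suc k)) / a) \<longlonglongrightarrow> (l - l) / a"
    using l LIMSEQ_Suc[OF l] a(1) by (intro tendsto_intros) auto
  then have lim: "(\<lambda>k. (H k - H (Suc k)) / a) \<longlonglongrightarrow> 0"
    by simp
  have "norm ((s k)\<^sup>2) \<le> (H k - H (Suc k)) / a" for k
    using a(2)[of k] a(1) by (simp add: field_simps)
  then have "(\<lambda>k. (s k)\<^sup>2) \<longlonglongrightarrow> 0"
    by (intro Lim_null_comparison[OF _ lim] always_eventually) blast
  then have "(\<lambda>k. sqrt ((s k)\<^sup>2)) \<longlonglongrightarrow> sqrt 0"
    by (rule tendsto_real_sqrt)
  moreover have "sqrt ((s k)\<^sup>2) = s k" for k
    using s_pos[of k] by simp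
  ultimately show ?thesis
    by simp
qed

lemma d_tendsto_0: "d \<longlonglongrightarrow> 0"
  by (rule Lim_null_comparison[OF _ s_tendsto_0]) (auto simp: s_def)

lemma G_tendsto_0: "(\<lambda>k. G (x k)) \<longlonglongrightarrow> 0"
proof -
  have "(\<lambda>k. G (x (Suc k))) \<longlonglongrightarrow> 0"
    by (rule Lim_null_comparison[OF _ tendsto_mult_right_zero[OF s_tendsto_0, of \<kappa>]])
      (simp add: norm_G_le)
  then show ?thesis
    by (rule LIMSEQ_imp_Suc)
qed

lemma G_accumulation_point: "G xb = 0" if "accumulation_point x xb"
  by (rule accumulation_point_limit_unique[OF that G_tendsto_0 isCont_G])

text \<open>Since \<open>d\<close> vanishes, \<open>f (x (Suc k))\<close> shares the limit of
  \<open>H\<close>, and continuity at \<open>xb\<close> identifies it.\<close>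

lemma H_tendsto:
  assumes "accumulation_point x xb"
  shows "H \<longlonglongrightarrow> f xb"
proof -
  obtain l where l: "H \<longlonglongrightarrow> l"
    using H_convergent by blast
  have "(\<lambda>k. H k - A * (norm (d k))\<^sup>2) \<longlonglongrightarrow> l - A * (norm (0::'a))\<^sup>2"
    by (intro tendsto_intros l d_tendsto_0)
  then have "(\<lambda>k. f (x (Suc k))) \<longlonglongrightarrow> l"
    by (simp add: H_def)
  then have "f xb = l"
    by (rule accumulation_point_limit_unique[OF assms LIMSEQ_imp_Suc isCont_f])
  with l show ?thesis by simp
qed

lemma gap_pos:
  assumes "accumulation_point x xb"
  shows "0 < H k - f xb"
proof -
  have "decseq H"
    using H_decreasing by (simp add: decseq_Suc_iff less_imp_le)
  then have "f xb \<le> H (Suc k)"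
    using decseq_ge[OF _ H_tendsto[OF assms]] by blast
  then show ?thesis
    using H_decreasing[of k] by simp
qed

lemma gap_tendsto_0: "(\<lambda>k. H k - f xb) \<longlonglongrightarrow> 0" if "accumulation_point x xb"
  using H_tendsto[OF that] by (simp add: LIM_zero)

section \<open>Convergence under the PLK condition\<close>

text \<open>The scaling is chosen so that the slope at \<open>t\<close> is
  \<open>deriv \<phi> (t / 2) + sqrt (2 * A) / sqrt t\<close>.\<close>

definition desing :: "(real \<Rightarrow> real) \<Rightarrow> real \<Rightarrow> real" where
  "desing \<phi> t = 2 * \<phi> (t / 2) + 2 * sqrt (2 * A) * sqrt t"

text \<open>The condition for \<open>f\<close> carries over to the Lyapunov values \<open>H k = f (x (k + 1)) + A |d k|\<^sup>2\<close>,
  with \<open>desing \<phi>\<close> in place of \<open>\<phi>\<close>: of the two terms that make up \<open>H k - f xb\<close>, one is at least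
  half of it; the first is controlled by \<open>\<phi>\<close> and the second by the square root.\<close>

lemma PLK_convergence:
  assumes acc: "accumulation_point x xb" and plk: "PLK_with f xb \<phi>"
  shows "x \<longlonglongrightarrow> xb"
    and "\<forall>\<^sub>F k in sequentially.
      1 \<le> (deriv \<phi> ((H k - f xb) / 2) + sqrt (2 * A) / sqrt (H k - f xb)) * (\<kappa> * s k)"
    and "\<exists>C>0. \<forall>\<^sub>F k in sequentially. norm (x (Suc k) - xb) \<le> C * desing \<phi> (H k - f xb)"
proof -
  define t where "t k = H k - f xb" for k
  define P where "P k = deriv \<phi> (t k / 2) + sqrt (2 * A) / sqrt (t k)" for k
  have t_pos: "0 < t k" for k
    using gap_pos[OF acc] by (simp add: t_def)
  obtain \<eta> r where \<eta>: "0 < \<eta>" and r: "0 < r"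
    and tangent: "\<And>u v. 0 < u \<Longrightarrow> u < \<eta> \<Longrightarrow> 0 < v \<Longrightarrow> v < \<eta> \<Longrightarrow> \<phi> u \<le> \<phi> v + deriv \<phi> v * (u - v)"
    and deriv_pos: "\<And>v. 0 < v \<Longrightarrow> v < \<eta> \<Longrightarrow> 0 < deriv \<phi> v"
    and \<phi>_nonneg: "\<And>v. 0 < v \<Longrightarrow> v < \<eta> \<Longrightarrow> 0 \<le> \<phi> v"
    and PLK: "\<And>y. y \<in> ball xb r \<Longrightarrow> f xb < f y \<Longrightarrow> f y < f xb + \<eta> \<Longrightarrow>
       1 \<le> deriv \<phi> (f y - f xb) * norm (G y)"
    by (rule PLK_withE[OF plk, unfolded grad_eq]) (rule that; assumption)
  \<comment> \<open>Slopes of a concave function decrease: the tangents at \<open>u\<close> and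
    \<open>v\<close>, each tested at the other point, are added.\<close>
  have deriv_antimono: "deriv \<phi> v \<le> deriv \<phi> u" if "0 < u" "u \<le> v" "v < \<eta>" for u v
  proof (cases "u = v")
    case False
    have "0 \<le> (deriv \<phi> u - deriv \<phi> v) * (v - u)"
      using tangent[of u v] tangent[of v u] that by (simp add: algebra_simps)
    then show ?thesis
      using False that by (simp add: zero_le_mult_iff)
  qed simp
  have "\<forall>\<^sub>F k in sequentially. t k < \<eta>"
    using gap_tendsto_0[OF acc] \<eta> unfolding t_def by (rule order_tendstoD)
  then obtain K where K: "\<And>k. K \<le> k \<Longrightarrow> t k < \<eta>"
    by (auto simp: eventually_sequentially)
  have P_pos: "0 < P k" if "K \<le> k" for k
    using deriv_pos[of "t k / 2"] t_pos[of k] K[OF that] A_pos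
    by (simp add: P_def add_pos_pos)
  have P_le: "1 \<le> P k * (\<kappa> * s k)" if k: "K \<le> k" and ball: "x (Suc k) \<in> ball xb r" for k
  proof (cases "t k / 2 \<le> f (x (Suc k)) - f xb")
    case True
    have le: "f (x (Suc k)) - f xb \<le> t k"
      using A_pos by (simp add: t_def H_def)
    have "1 \<le> deriv \<phi> (f (x (Suc k)) - f xb) * norm (G (x (Suc k)))"
      using PLK[OF ball] True t_pos[of k] le K[OF k] by simp
    also have "\<dots> \<le> P k * (\<kappa> * s k)"
    proof (rule mult_mono)
      have "0 \<le> sqrt (2 * A) / sqrt (t k)"
        using A_pos t_pos[of k] by simp
      \<comment> \<open>Here the function gap is at least \<open>t k / 2\<close>, so moving to
        \<open>t k / 2\<close> can only raise the slope.\<close>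
      then show "deriv \<phi> (f (x (Suc k)) - f xb) \<le> P k"
        using deriv_antimono[of "t k / 2" "f (x (Suc k)) - f xb"] True t_pos[of k] le K[OF k]
        by (simp add: P_def)
    qed (use P_pos[OF k] norm_G_le in auto)
    finally show ?thesis .
  next
    case False
    then have "t k / 2 \<le> A * (norm (d k))\<^sup>2"
      by (simp add: t_def H_def)
    then have "sqrt (t k) \<le> sqrt (2 * A * (norm (d k))\<^sup>2)"
      by (intro real_sqrt_le_mono) simp
    then have "1 \<le> sqrt (2 * A) / sqrt (t k) * norm (d k)"
      using t_pos[of k] A_pos by (simp add: real_sqrt_mult field_simps)
    also have "\<dots> \<le> P k * (\<kappa> * s k)"
    proof (rule mult_mono)
      show "sqrt (2 * A) / sqrt (t k) \<le> P k"
        using deriv_pos[of "t k / 2"] t_pos[of k] K[OF k] by (simp add: P_def)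
    qed (use P_pos[OF k] norm_d_le in auto)
    finally show ?thesis .
  qed
  \<comment> \<open>The tangent inequality of the concave \<open>desing \<phi>\<close>, proved
    summand by summand; for the square root it amounts to \<open>a + b \<le> 2 * a\<close>.\<close>
  have desing_decrease: "P k * (t k - t (Suc k)) \<le> desing \<phi> (t k) - desing \<phi> (t (Suc k))"
    if k: "K \<le> k" for k
  proof -
    define a where "a = sqrt (t k)"
    define b where "b = sqrt (t (Suc k))"
    have ab: "t k = a\<^sup>2" "t (Suc k) = b\<^sup>2" "0 < a" "0 < b"
      using t_pos[of k] t_pos[of "Suc k"] by (auto simp: a_def b_def)
    have "b \<le> a"
      using H_decreasing[of k] by (simp add: a_def b_def t_def)
    then have "(a - b) * (a + b) \<le> (a - b) * (2 * a)"
      by (intro mult_left_mono) auto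
    then have "(a\<^sup>2 - b\<^sup>2) / a \<le> 2 * (a - b)"
      using ab by (simp add: field_simps power2_eq_square)
    then have "sqrt (2 * A) * ((a\<^sup>2 - b\<^sup>2) / a) \<le> sqrt (2 * A) * (2 * (a - b))"
      using A_pos by (intro mult_left_mono) auto
    then have 1: "sqrt (2 * A) / sqrt (t k) * (t k - t (Suc k))
        \<le> 2 * sqrt (2 * A) * sqrt (t k) - 2 * sqrt (2 * A) * sqrt (t (Suc k))"
      unfolding a_def[symmetric] b_def[symmetric] unfolding ab by (simp add: algebra_simps)
    have "\<phi> (t (Suc k) / 2) \<le> \<phi> (t k / 2) + deriv \<phi> (t k / 2) * (t (Suc k) / 2 - t k / 2)"
      using t_pos[of k] t_pos[of "Suc k"] K[of k] K[of "Suc k"] k by (intro tangent) auto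
    then have "deriv \<phi> (t k / 2) * (t k - t (Suc k)) \<le> 2 * \<phi> (t k / 2) - 2 * \<phi> (t (Suc k) / 2)"
      by (simp add: field_simps)
    with 1 show ?thesis
      by (simp add: P_def desing_def distrib_right)
  qed
  obtain a where a: "0 < a" "\<And>k. a * (s k)\<^sup>2 \<le> H k - H (Suc k)"
    using descent by blast
  define C where "C = (\<beta>b + \<tau>) * (\<kappa> / a)"
  have C_pos: "0 < C"
    using \<beta>b_nonneg \<tau>_pos \<kappa>_pos a(1) by (simp add: C_def add_nonneg_pos)
  define u where "u k = C * desing \<phi> (t k)" for k
  have step: "norm (x (Suc (Suc k)) - x (Suc k)) \<le> u k - u (Suc k)"
    if k: "K \<le> k" and ball: "x (Suc k) \<in> ball xb r" for k
  proof -
    \<comment> \<open>Replacing the factor 1 by \<open>P k * (\<kappa> * s k)\<close> creates the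
      square to which the descent estimate applies, so \<open>s k\<close> itself becomes bounded by
      a telescoping difference.\<close>
    have "a * s k = a * s k * 1" by simp
    also have "\<dots> \<le> a * s k * (P k * (\<kappa> * s k))"
      using P_le[OF k ball] a(1) s_pos[of k] by (intro mult_left_mono) auto
    also have "\<dots> = \<kappa> * (P k * (a * (s k)\<^sup>2))"
      by (simp add: power2_eq_square)
    also have "\<dots> \<le> \<kappa> * (P k * (t k - t (Suc k)))"
      using a(2)[of k] \<kappa>_pos P_pos[OF k] by (intro mult_left_mono) (auto simp: t_def)
    also have "\<dots> \<le> \<kappa> * (desing \<phi> (t k) - desing \<phi> (t (Suc k)))"
      using desing_decrease[OF k] \<kappa>_pos by (intro mult_left_mono) auto
    finally have "s k \<le> \<kappa> / a * (desing \<phi> (t k) - desing \<phi> (t (Suc k)))"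
      using a(1) by (simp add: field_simps)
    then have "(\<beta>b + \<tau>) * s k \<le> (\<beta>b + \<tau>) * (\<kappa> / a * (desing \<phi> (t k) - desing \<phi> (t (Suc k))))"
      using \<beta>b_nonneg \<tau>_pos by (intro mult_left_mono) auto
    then show ?thesis
      using norm_d_Suc_le[of k] by (simp add: d_def u_def C_def algebra_simps)
  qed
  have dec: "u (Suc k) \<le> u k" if k: "K \<le> k" for k
  proof -
    have "0 \<le> P k * (t k - t (Suc k))"
      using P_pos[OF k] H_decreasing[of k] by (simp add: t_def)
    then show ?thesis
      using desing_decrease[OF k] C_pos by (simp add: u_def)
  qed
  have nonneg: "0 \<le> u k" if "K \<le> k" for k
    using \<phi>_nonneg[of "t k / 2"] t_pos[of k] K[OF that] A_pos C_pos by (simp add: u_def desing_def)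
  \<comment> \<open>The argument runs on the shifted sequence, because \<open>H k\<close> evaluates
    \<open>f\<close> at \<open>x (Suc k)\<close>.\<close>
  have bound: "\<forall>\<^sub>F k in sequentially. norm (x (Suc k) - xb) \<le> u k"
    and lim: "(\<lambda>k. x (Suc k)) \<longlonglongrightarrow> xb"
    by (rule trapped_near_accumulation_point[OF accumulation_point_Suc[OF acc] r step dec nonneg]; simp)+
  show "x \<longlonglongrightarrow> xb"
    by (rule LIMSEQ_imp_Suc[OF lim])
  have "\<forall>\<^sub>F k in sequentially. dist (x (Suc k)) xb < r"
    using tendstoD[OF lim r] .
  then show "\<forall>\<^sub>F k in sequentially.
      1 \<le> (deriv \<phi> ((H k - f xb) / 2) + sqrt (2 * A) / sqrt (H k - f xb)) * (\<kappa> * s k)"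
    using eventually_ge_at_top[of K]
    by eventually_elim (use P_le in \<open>simp add: P_def t_def dist_commute\<close>)
  show "\<exists>C>0. \<forall>\<^sub>F k in sequentially. norm (x (Suc k) - xb) \<le> C * desing \<phi> (H k - f xb)"
    using C_pos bound by (auto simp: u_def t_def)
qed

end

text \<open>Gaps at \<open>k\<close> control the iterate at \<open>Suc k\<close>; this undoes the
  shift in the rate statements.\<close>

lemma eventually_Suc_bigo:
  fixes F w :: "nat \<Rightarrow> real"
  assumes "\<forall>\<^sub>F k in sequentially. \<bar>F (Suc k)\<bar> \<le> C * \<bar>w (Suc k)\<bar>"
  shows "F \<in> O(w)"
proof (rule bigoI)
  show "\<forall>\<^sub>F k in sequentially. norm (F k) \<le> C * norm (w k)"
    using assms unfolding eventually_sequentially_Suc[of "\<lambda>k. \<bar>F k\<bar> \<le> C * \<bar>w k\<bar>"] by simp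
qed

section \<open>Convergence rates\<close>

context inexact_momentum_gradient
begin

text \<open>Besides the power of \<open>\<phi>\<close>, \<open>desing\<close> carries a square root.
  For gaps below 1 the worse exponent dominates both, hence \<open>\<theta>\<close>. The slope bound
  then makes \<open>s k\<close> at least a multiple of \<open>t k powr \<theta>\<close>, which is
  inserted into the descent estimate.\<close>

lemma power_PLK_recursion:
  assumes acc: "accumulation_point x xb" and M: "0 < M" and q: "0 \<le> q" "q < 1"
    and plk: "PLK_with f xb (\<lambda>t. M * t powr (1 - q))"
    and \<theta>: "\<theta> = max q (1 / 2)"
  shows "\<exists>a>0. \<exists>C>0. \<forall>\<^sub>F k in sequentially.
    H (Suc k) - f xb \<le> (H k - f xb) - a * (H k - f xb) powr (2 * \<theta>) \<and>
    norm (x (Suc k) - xb) \<le> C * (H k - f xb) powr (1 - \<theta>)"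
proof -
  define t where "t k = H k - f xb" for k
  define \<phi> where "\<phi> = (\<lambda>t. M * t powr (1 - q))"
  define N where "N = sqrt (2 * A)"
  have N: "0 < N" using A_pos by (simp add: N_def)
  have t_pos: "0 < t k" for k
    using gap_pos[OF acc] by (simp add: t_def)
  have deriv: "deriv \<phi> v = M * ((1 - q) * v powr (- q))" if "0 < v" for v
  proof -
    have "(\<phi> has_real_derivative M * ((1 - q) * v powr (1 - q - 1))) (at v)"
      unfolding \<phi>_def by (intro DERIV_cmult has_real_derivative_powr that)
    then show ?thesis by (simp add: DERIV_imp_deriv)
  qed
  have powr_le: "v powr b \<le> v powr b'" if "0 < v" "v \<le> 1" "b' \<le> b" for v b b' :: real
    using that by (intro powr_mono') auto
  have desing_le: "desing \<phi> v \<le> (2 * M + 2 * N) * v powr (1 - \<theta>)" if v: "0 < v" "v \<le> 1" for v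
  proof -
    have "(v / 2) powr (1 - q) \<le> v powr (1 - q)"
      using v q by (intro powr_mono2) auto
    also have "\<dots> \<le> v powr (1 - \<theta>)"
      using v by (intro powr_le) (auto simp: \<theta>)
    finally have "2 * \<phi> (v / 2) \<le> 2 * M * v powr (1 - \<theta>)"
      using M by (simp add: \<phi>_def)
    moreover have "sqrt v \<le> v powr (1 - \<theta>)"
      unfolding powr_half_sqrt[symmetric, OF less_imp_le[OF v(1)]]
      using v q by (intro powr_le) (auto simp: \<theta>)
    then have "2 * N * sqrt v \<le> 2 * N * v powr (1 - \<theta>)"
      using N by simp
    ultimately show ?thesis
      by (simp add: desing_def N_def distrib_right)
  qed
  have slope_le: "deriv \<phi> (v / 2) + N / sqrt v \<le> (2 * M + N) * v powr (- \<theta>)"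
    if v: "0 < v" "v \<le> 1" for v
  proof -
    have "(1 - q) * (v / 2) powr (- q) \<le> 1 * (2 * v powr (- \<theta>))"
    proof (rule mult_mono)
      have "(v / 2) powr (- q) = 2 powr q * v powr (- q)"
        using v by (simp add: powr_divide powr_minus field_simps)
      also have "\<dots> \<le> 2 powr 1 * v powr (- \<theta>)"
        using v q by (intro mult_mono powr_mono powr_le) (auto simp: \<theta>)
      finally show "(v / 2) powr (- q) \<le> 2 * v powr (- \<theta>)" by simp
    qed (use q in auto)
    then have "deriv \<phi> (v / 2) \<le> M * (2 * v powr (- \<theta>))"
      using v M by (simp add: deriv)
    moreover have "1 / sqrt v = v powr (- (1 / 2))"
      using v by (simp add: powr_minus powr_half_sqrt field_simps)
    then have "1 / sqrt v \<le> v powr (- \<theta>)"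
      using powr_le[OF v, of "- \<theta>" "- (1 / 2)"] by (simp add: \<theta>)
    then have "N * (1 / sqrt v) \<le> N * v powr (- \<theta>)"
      using N by (intro mult_left_mono) auto
    ultimately show ?thesis
      by (simp add: algebra_simps)
  qed
  obtain C0 where C0: "0 < C0"
    and dist_le: "\<forall>\<^sub>F k in sequentially. norm (x (Suc k) - xb) \<le> C0 * desing \<phi> (t k)"
    using PLK_convergence(3)[OF acc plk] unfolding \<phi>_def t_def by blast
  obtain a where a: "0 < a" "\<And>k. a * (s k)\<^sup>2 \<le> H k - H (Suc k)"
    using descent by blast
  define D where "D = (2 * M + N) * \<kappa>"
  have D: "0 < D"
    using M N \<kappa>_pos by (simp add: D_def)
  have slope: "\<forall>\<^sub>F k in sequentially. 1 \<le> (deriv \<phi> (t k / 2) + N / sqrt (t k)) * (\<kappa> * s k)"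
    using PLK_convergence(2)[OF acc plk] unfolding \<phi>_def t_def N_def .
  have small: "\<forall>\<^sub>F k in sequentially. t k < 1"
    using gap_tendsto_0[OF acc] unfolding t_def by (rule order_tendstoD) simp
  have "\<forall>\<^sub>F k in sequentially. t (Suc k) \<le> t k - a / D\<^sup>2 * t k powr (2 * \<theta>) \<and>
      norm (x (Suc k) - xb) \<le> C0 * (2 * M + 2 * N) * t k powr (1 - \<theta>)"
    using slope dist_le small
  proof eventually_elim
    case (elim k)
    have tk: "0 < t k" "t k \<le> 1"
      using t_pos[of k] elim(3) by auto
    have "1 \<le> (2 * M + N) * t k powr (- \<theta>) * (\<kappa> * s k)"
      using order_trans[OF elim(1) mult_right_mono[OF slope_le[OF tk]]] \<kappa>_pos s_pos[of k] by simp
    then have "t k powr \<theta> \<le> D * s k"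
      using tk by (simp add: D_def powr_minus field_simps)
    then have "(t k powr \<theta>)\<^sup>2 \<le> (D * s k)\<^sup>2"
      by (intro power_mono) auto
    then have "t k powr (2 * \<theta>) \<le> D\<^sup>2 * (s k)\<^sup>2"
      by (simp add: power_mult_distrib powr_add[symmetric] power2_eq_square[of "_ powr _"])
    then have "a / D\<^sup>2 * t k powr (2 * \<theta>) \<le> a / D\<^sup>2 * (D\<^sup>2 * (s k)\<^sup>2)"
      using a(1) by (intro mult_left_mono) auto
    also have "\<dots> = a * (s k)\<^sup>2"
      using D by simp
    finally have 1: "t (Suc k) \<le> t k - a / D\<^sup>2 * t k powr (2 * \<theta>)"
      using a(2)[of k] by (simp add: t_def)
    have "C0 * desing \<phi> (t k) \<le> C0 * ((2 * M + 2 * N) * t k powr (1 - \<theta>))"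
      using C0 desing_le[OF tk] by (intro mult_left_mono) auto
    with 1 elim(2) show ?case by (simp add: mult.assoc)
  qed
  moreover have "0 < a / D\<^sup>2" "0 < C0 * (2 * M + 2 * N)"
    using a(1) D C0 M N by (auto intro!: mult_pos_pos add_pos_pos)
  ultimately show ?thesis
    unfolding t_def by blast
qed

lemma linear_rate:
  assumes acc: "accumulation_point x xb" and M: "0 < M" and q: "0 \<le> q" "q \<le> 1 / 2"
    and plk: "PLK_with f xb (\<lambda>t. M * t powr (1 - q))"
  shows "\<exists>\<mu>. 0 < \<mu> \<and> \<mu> < 1 \<and> (\<lambda>k. norm (x k - xb)) \<in> O(\<lambda>k. \<mu> ^ k)"
proof -
  define t where "t k = H k - f xb" for k
  have t_pos: "0 < t k" for k
    using gap_pos[OF acc] by (simp add: t_def)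
  have "\<exists>a>0. \<exists>C>0. \<forall>\<^sub>F k in sequentially. t (Suc k) \<le> t k - a * t k powr (2 * (1 / 2)) \<and>
        norm (x (Suc k) - xb) \<le> C * t k powr (1 - 1 / 2)"
    unfolding t_def by (rule power_PLK_recursion[OF acc M q(1) _ plk]) (use q in auto)
  then obtain a C where a: "0 < a" and C: "0 < C"
    and ev: "\<forall>\<^sub>F k in sequentially. t (Suc k) \<le> t k - a * t k powr (2 * (1 / 2)) \<and>
        norm (x (Suc k) - xb) \<le> C * t k powr (1 - 1 / 2)"
    by blast
  have simps: "t k powr (2 * (1 / 2)) = t k" "t k powr (1 - 1 / 2) = sqrt (t k)" for k
    using t_pos[of k] by (simp_all add: powr_half_sqrt)
  from ev obtain K where K: "\<And>k. K \<le> k \<Longrightarrow> t (Suc k) \<le> (1 - a) * t k"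
      "\<And>k. K \<le> k \<Longrightarrow> norm (x (Suc k) - xb) \<le> C * sqrt (t k)"
    unfolding simps eventually_sequentially by (auto simp: algebra_simps)
  define m where "m = 1 - a"
  \<comment> \<open>Gaps stay positive, which forces \<open>a < 1\<close> and makes \<open>m\<close>
    a genuine contraction factor.\<close>
  have "0 < m * t K"
    using K(1)[of K] t_pos[of "Suc K"] unfolding m_def by simp
  then have m: "0 < m" "m < 1"
    using t_pos[of K] a by (auto simp: zero_less_mult_iff m_def)
  define \<mu> where "\<mu> = sqrt m"
  have \<mu>: "0 < \<mu>" "\<mu> < 1"
    using m by (auto simp: \<mu>_def)
  define E where "E = t K / m ^ K"
  \<comment> \<open>Distances behave like square roots of gaps, so the ratio is
    \<open>sqrt m\<close>; dividing by \<open>\<mu>\<close> pays for the shifted index.\<close>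
  have "norm (x (Suc k) - xb) \<le> C * sqrt E / \<mu> * \<bar>\<mu> ^ Suc k\<bar>" if k: "K \<le> k" for k
  proof -
    have "t k \<le> E * m ^ k"
      using geometric_decay[where t = t, OF m(1) K(1)[folded m_def] k] by (simp add: E_def)
    then have "sqrt (t k) \<le> sqrt E * \<mu> ^ k"
      unfolding \<mu>_def real_sqrt_power[symmetric] real_sqrt_mult[symmetric]
      by (rule real_sqrt_le_mono)
    then have "C * sqrt (t k) \<le> C * (sqrt E * \<mu> ^ k)"
      using C by (intro mult_left_mono) auto
    then show ?thesis
      using K(2)[OF k] \<mu> by simp
  qed
  then have "(\<lambda>k. norm (x k - xb)) \<in> O(\<lambda>k. \<mu> ^ k)"
    by (intro eventually_Suc_bigo[of _ "C * sqrt E / \<mu>"]) (auto simp: eventually_sequentially)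
  with \<mu> show ?thesis by blast
qed

text \<open>Here \<open>\<theta> = q\<close>, and the recursion exponent
  \<open>2 * q = 1 + \<alpha>\<close> makes the gap decay with power \<open>- 1 / \<alpha>\<close>;
  the distance is of the order of its power \<open>1 - q\<close>.\<close>

lemma sublinear_rate:
  assumes acc: "accumulation_point x xb" and M: "0 < M" and q: "1 / 2 < q" "q < 1"
    and plk: "PLK_with f xb (\<lambda>t. M * t powr (1 - q))"
  shows "(\<lambda>k. norm (x k - xb)) \<in> O(\<lambda>k. real k powr (- (1 - q) / (2 * q - 1)))"
proof -
  define t where "t k = H k - f xb" for k
  define \<alpha> where "\<alpha> = 2 * q - 1"
  have t_pos: "0 < t k" for k
    using gap_pos[OF acc] by (simp add: t_def)
  have \<alpha>: "0 < \<alpha>" "2 * q = 1 + \<alpha>"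
    using q by (auto simp: \<alpha>_def)
  have "\<exists>a>0. \<exists>C>0. \<forall>\<^sub>F k in sequentially. t (Suc k) \<le> t k - a * t k powr (1 + \<alpha>) \<and>
        norm (x (Suc k) - xb) \<le> C * t k powr (1 - q)"
    unfolding t_def \<alpha>(2)[symmetric]
    by (rule power_PLK_recursion[OF acc M _ q(2) plk]) (use q in auto)
  then obtain a C where a: "0 < a" and C: "0 < C"
    and ev: "\<forall>\<^sub>F k in sequentially. t (Suc k) \<le> t k - a * t k powr (1 + \<alpha>) \<and>
        norm (x (Suc k) - xb) \<le> C * t k powr (1 - q)"
    by blast
  from ev obtain K where K: "\<And>k. K \<le> k \<Longrightarrow> t (Suc k) \<le> t k - a * t k powr (1 + \<alpha>)"
    by (auto simp: eventually_sequentially)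
  obtain E where E: "0 < E" "\<forall>\<^sub>F k in sequentially. t k \<le> E * real (Suc k) powr (- 1 / \<alpha>)"
    using polynomial_decay[where t = t, OF \<alpha>(1) a t_pos K] by blast
  have "\<forall>\<^sub>F k in sequentially. \<bar>norm (x (Suc k) - xb)\<bar>
      \<le> C * E powr (1 - q) * \<bar>real (Suc k) powr (- (1 - q) / (2 * q - 1))\<bar>"
    using ev E(2)
  proof eventually_elim
    case (elim k)
    have "t k powr (1 - q) \<le> (E * real (Suc k) powr (- 1 / \<alpha>)) powr (1 - q)"
      using elim(2) t_pos[of k] q by (intro powr_mono2) auto
    also have "\<dots> = E powr (1 - q) * (real (Suc k) powr (- 1 / \<alpha>)) powr (1 - q)"
      by (rule powr_mult)
    also have "(real (Suc k) powr (- 1 / \<alpha>)) powr (1 - q) = real (Suc k) powr (- (1 - q) / (2 * q - 1))"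
      by (simp only: powr_powr \<alpha>_def times_divide_eq_left mult_minus1)
    finally have "C * t k powr (1 - q) \<le>
        C * (E powr (1 - q) * real (Suc k) powr (- (1 - q) / (2 * q - 1)))"
      using C by (intro mult_left_mono) auto
    with elim(1) show ?case by (simp add: mult.assoc)
  qed
  then show ?thesis
    by (rule eventually_Suc_bigo)
qed

end

section \<open>Transfer of the abstract analysis to the proximal iteration\<close>

theorem theorem4p11:
  fixes h :: "real ^ 'n \<Rightarrow> ereal"
    and \<rho> lam \<tau> \<nu> \<beta>b \<delta>b L :: real
    and \<beta> \<gamma> :: "nat \<Rightarrow> real"
    and p x :: "nat \<Rightarrow> real ^ 'n"
    and e :: "real ^ 'n \<Rightarrow> real"
  defines "\<beta>b \<equiv> (SUP k\<in>{1..}. \<beta> k)"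
    and "\<delta>b \<equiv> (SUP k\<in>{1..}. \<bar>\<beta> k - \<gamma> k\<bar>)"
    and "L \<equiv> max (1 / lam) (\<rho> / (1 - lam * \<rho>))"
    and "e \<equiv> (\<lambda>y. real_of_ereal (moreau_envelope lam h y))"
  assumes "proper_fun h" and "lsc_fun h"
    and "0 \<le> \<rho>" and "weakly_convex \<rho> h"
    and "\<exists>c::real. \<forall>y. ereal c \<le> h y"
    and "0 < \<nu>" and "\<nu> < 1" and "0 < \<tau>"
    and "\<forall>k\<ge>1. 0 \<le> \<beta> k" and "\<forall>k\<ge>1. 0 \<le> \<gamma> k"
    and "bdd_above (\<beta> ` {1..})" and "\<beta>b < 1"
    and "bdd_above ((\<lambda>k. \<bar>\<beta> k - \<gamma> k\<bar>) ` {1..})"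
    and "0 < lam" and "ereal lam < inverse (ereal \<rho>)"
    and "max (L * \<tau>) (2 * L * \<tau> * \<delta>b + (L * \<tau> + 1) * \<beta>b\<^sup>2) < 1 - \<nu>"
    and "IPPm h lam \<tau> \<nu> \<beta> \<gamma> p x"
    and "\<forall>k\<ge>1. 0 \<notin> limiting_subdiff h (extrapolation \<gamma> x k)"
  shows "(\<forall>xb. accumulation_point x xb \<longrightarrow> 0 \<in> limiting_subdiff h xb) \<and>
    (\<forall>xb. accumulation_point x xb \<and> basic_PLK e xb \<longrightarrow> x \<longlonglongrightarrow> xb) \<and>
    (\<forall>xb M q. accumulation_point x xb \<and> 0 < M \<and> 0 \<le> q \<and> q < 1 \<and>
        PLK_with e xb (\<lambda>t. M * t powr (1 - q)) \<longrightarrow>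
      (q \<le> 1 / 2 \<longrightarrow>
         converges_linearly x xb \<and>
         converges_linearly (\<lambda>k. x k - Prox lam h (x k)) 0) \<and>
      (1 / 2 < q \<longrightarrow>
         (\<lambda>k. norm (x k - xb)) \<in> O(\<lambda>k. real k powr (- (1 - q) / (2 * q - 1))) \<and>
         (\<lambda>k. norm (x k - Prox lam h (x k))) \<in> O(\<lambda>k. real k powr (- (1 - q) / (2 * q - 1)))))"
proof -
  obtain c where c: "\<And>y. ereal c \<le> h y"
    using assms(9) by blast
  have "lam * \<rho> < 1"
  \<comment> \<open>The inverse of 0 is \<open>\<infinity>\<close> in the extended reals, so this
    case is separate.\<close>
  proof (cases "\<rho> = 0")
    case False
    then show ?thesis
      using assms(7,19) by (simp add: field_simps)
  qed simp
  then interpret P: weakly_convex_prox h \<rho> lam c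
    using assms(5-8,18) c by unfold_locales
  have e_eq: "e = P.envelope"
    by (simp add: fun_eq_iff e_def P.envelope_def)
  have L_ge: "1 / lam \<le> L" "\<rho> / (1 - lam * \<rho>) \<le> L"
    by (auto simp: L_def)
  have L_pos: "0 < L"
    using L_ge(1) P.lam_pos less_le_trans[of 0 "1 / lam" L] by simp
  have \<beta>b: "\<beta> (Suc k) \<le> \<beta>b" for k
    unfolding \<beta>b_def by (rule cSUP_upper[OF _ assms(15)]) simp
  have \<delta>b: "\<bar>\<beta> (Suc k) - \<gamma> (Suc k)\<bar> \<le> \<delta>b" for k
    unfolding \<delta>b_def by (rule cSUP_upper[OF _ assms(17)]) simp
  define ex where "ex k = extrapolation \<gamma> x (Suc k)" for k
  define g where "g k = (1 / lam) *\<^sub>R (ex k - p (Suc k))" for k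
  have ex: "ex k = x (Suc k) + \<gamma> (Suc k) *\<^sub>R (x (Suc k) - x k)" for k
    by (simp add: ex_def extrapolation_def)
  have iter: "norm (p (Suc k) - Prox lam h (ex k)) \<le> \<nu> * norm (p (Suc k) - ex k)"
    "x (Suc (Suc k)) = x (Suc k) + \<beta> (Suc k) *\<^sub>R (x (Suc k) - x k) - \<tau> *\<^sub>R g k" for k
    using assms(21)[unfolded IPPm_def Let_def, THEN conjunct2, rule_format, of "Suc k"]
    by (simp_all add: ex_def g_def extrapolation_def)
  \<comment> \<open>The parameter sequences are shifted because their bounds are assumed only from
    index 1 on; \<open>x\<close> keeps its own indexing.\<close>
  interpret I: inexact_momentum_gradient P.envelope P.envelope_grad L \<tau> \<nu> \<beta>b \<delta>b c
    "\<lambda>k. \<beta> (Suc k)" "\<lambda>k. \<gamma> (Suc k)" x g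
  proof
    fix k :: nat and y z :: "real ^ 'n"
    have "1 / (2 * lam) * (norm (z - y))\<^sup>2 \<le> L / 2 * (norm (z - y))\<^sup>2"
      using mult_right_mono[OF L_ge(1), of "(norm (z - y))\<^sup>2"] by simp
    moreover have "\<rho> / (1 - lam * \<rho>) / 2 * (norm (z - y))\<^sup>2 \<le> L / 2 * (norm (z - y))\<^sup>2"
      by (intro mult_right_mono divide_right_mono L_ge) auto
    ultimately show "\<bar>P.envelope z - P.envelope y - P.envelope_grad y \<bullet> (z - y)\<bar>
        \<le> L / 2 * (norm (z - y))\<^sup>2"
      using P.envelope_upper[of z y] P.envelope_lower_quadratic[of y z] by linarith
    show "norm (P.envelope_grad y - P.envelope_grad z) \<le> L * norm (y - z)"
      unfolding L_def by (rule P.envelope_grad_lipschitz)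
    have "P.envelope_grad (ex k) - g k = (1 / lam) *\<^sub>R (p (Suc k) - Prox lam h (ex k))"
      by (simp add: P.envelope_grad_def g_def algebra_simps)
    then have "norm (P.envelope_grad (ex k) - g k) = 1 / lam * norm (p (Suc k) - Prox lam h (ex k))"
      using P.lam_pos by simp
    also have "\<dots> \<le> 1 / lam * (\<nu> * norm (p (Suc k) - ex k))"
      using P.lam_pos iter(1)[of k] by (intro mult_left_mono) auto
    also have "\<dots> = \<nu> * norm (g k)"
      using P.lam_pos by (simp add: g_def norm_minus_commute)
    finally show "norm (P.envelope_grad (x (Suc k) + \<gamma> (Suc k) *\<^sub>R (x (Suc k) - x k)) - g k)
        \<le> \<nu> * norm (g k)"
      by (simp only: ex)
    \<comment> \<open>A vanishing inexact gradient would leave no room for error, making the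
      extrapolated point a proximal fixed point and hence stationary.\<close>
    show "g k \<noteq> 0"
    proof
      assume "g k = 0"
      then have "p (Suc k) = ex k"
        using P.lam_pos by (simp add: g_def)
      then have "Prox lam h (ex k) = ex k"
        using iter(1)[of k] by simp
      then have "0 \<in> limiting_subdiff h (ex k)"
        by (rule P.Prox_fixed_point_stationary)
      then show False
        using assms(22) by (simp add: ex_def)
    qed
  qed (use assms P.envelope_lower L_pos \<beta>b \<delta>b iter in auto)
  have stationary: "Prox lam h xb = xb" if "accumulation_point x xb" for xb
    using I.G_accumulation_point[OF that] P.Prox_eq[of xb] by simp
  \<comment> \<open>The residual is \<open>lam\<close> times the norm of a Lipschitz gradient that
    vanishes at \<open>xb\<close>, so it inherits any rate of the iterates.\<close>
  have residual: "(\<lambda>k. norm (x k - Prox lam h (x k))) \<in> O(\<lambda>k. norm (x k - xb))"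
    if "accumulation_point x xb" for xb
  proof (rule bigoI)
    have "norm (x k - Prox lam h (x k)) \<le> lam * L * norm (x k - xb)" for k
      using mult_left_mono[OF I.lipschitz[of "x k" xb], of lam] P.lam_pos
        I.G_accumulation_point[OF that] by (simp add: P.Prox_eq)
    then show "\<forall>\<^sub>F k in sequentially.
        norm (norm (x k - Prox lam h (x k))) \<le> lam * L * norm (norm (x k - xb))"
      by simp
  qed
  show ?thesis
  proof (intro conjI allI impI; (elim conjE)?)
    fix xb assume "accumulation_point x xb"
    then show "0 \<in> limiting_subdiff h xb"
      by (intro P.Prox_fixed_point_stationary stationary)
  next
    fix xb assume "accumulation_point x xb" "basic_PLK e xb"
    then show "x \<longlonglongrightarrow> xb"
      unfolding basic_PLK_def e_eq using I.PLK_convergence(1) by blast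
  next
    fix xb M q
    assume acc: "accumulation_point x xb" and "0 < M" "0 \<le> q" "q \<le> 1 / 2"
      "PLK_with e xb (\<lambda>t. M * t powr (1 - q))"
    then obtain \<mu> where "0 < \<mu>" "\<mu> < 1" "(\<lambda>k. norm (x k - xb)) \<in> O(\<lambda>k. \<mu> ^ k)"
      using I.linear_rate unfolding e_eq by blast
    then show "converges_linearly x xb" "converges_linearly (\<lambda>k. x k - Prox lam h (x k)) 0"
      using landau_o.big_trans[OF residual[OF acc]] unfolding converges_linearly_def by auto
  next
    fix xb M q
    assume acc: "accumulation_point x xb" and "0 < M" "1 / 2 < q" "q < 1"
      "PLK_with e xb (\<lambda>t. M * t powr (1 - q))"
    then show rate: "(\<lambda>k. norm (x k - xb)) \<in> O(\<lambda>k. real k powr (- (1 - q) / (2 * q - 1)))"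
      using I.sublinear_rate unfolding e_eq by blast
    then show "(\<lambda>k. norm (x k - Prox lam h (x k))) \<in> O(\<lambda>k. real k powr (- (1 - q) / (2 * q - 1)))"
      by (rule landau_o.big_trans[OF residual[OF acc]])
  qed
qed

end
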